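(* Let $X$ be a pointed metric space, $E$ a Banach space, $\alpha$ a dualizable Lipschitz cross-norm on $X\boxtimes E$, and $\alpha'$ the associated Lipschitz norm of $\alpha$ on the associated Lipschitz tensor product $X^\#\boxdot E^*$. (i) $\left(\mathrm{Lip}_{0F}(X,E^* ),\mathrm{Lip}_\alpha\right)$ is isometrically isomorphic to $X^\#\boxdot_{\alpha'}E^*$, via the map $K\colon X^\#\boxdot_{\alpha'}E^*\to\mathrm{Lip}_{0F}(X,E^* )$ given by $$K\left(\sum_{j=1}^m g_j\boxtimes\phi_j\right)=\sum_{j=1}^m g_j\cdot\phi_j.$$ (ii) The space of all $\alpha$-Lipschitz approximable operators from $X$ into $E^*$ (with norm $\mathrm{Lip}_\alpha$) is isometrically isomorphic to the completion $X^\#\widehat{\boxdot}_{\alpha'}E^*$ of $X^\#\boxdot_{\alpha'}E^*$.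
   Context: $\mathbb{K}$ is $\mathbb R$ or $\mathbb C$. A pointed metric space $X$ is a metric space with metric $d$ and a designated base point $0$; a normed space is pointed by its zero vector. For a Banach space $F$, $\mathrm{Lip}_0(X,F)$ is the space of base-point preserving Lipschitz maps $X\to F$, with norm $\mathrm{Lip}$ (least Lipschitz constant); $X^\#=\mathrm{Lip}_0(X,\mathbb K)$; $E^*$ is the topological dual. The Lipschitz tensor product $X\boxtimes E$ is the linear span of all linear functionals $\delta_{(x,y)}\boxtimes e$ on $\mathrm{Lip}_0(X,E^* )$ of the form $(\delta_{(x,y)}\boxtimes e)(f)=\langle f(x)-f(y),e\rangle$, for $x,y\in X$ and $e\in E$. A norm $\alpha$ on $X\boxtimes E$ is a Lipschitz cross-norm if $\alpha(\delta_{(x,y)}\boxtimes e)=d(x,y)\|e\|$ always. It is dualizable if $\left|\sum_{i=1}^n(g(x_i)-g(y_i))\langle\phi,e_i\rangle\right|\le\mathrm{Lip}(g)\|\phi\|\,\alpha\left(\sum_{i=1}^n\delta_{(x_i,y_i)}\boxtimes e_i\right)$ for all $g\in X^\#$, $\phi\in E^*$ and $\sum_{i=1}^n\delta_{(x_i,y_i)}\boxtimes e_i\in X\boxtimes E$. A base-point preserving map $f\colon X\to E^*$ is an $\alpha$-Lipschitz operator if there is $C\ge 0$ with $\left|\sum_{i=1}^n\langle f(x_i)-f(y_i),e_i\rangle\right|\le C\,\alpha\left(\sum_{i=1}^n\delta_{(x_i,y_i)}\boxtimes e_i\right)$ for all $\sum_{i=1}^n\delta_{(x_i,y_i)}\boxtimes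 e_i\in X\boxtimes E$; the infimum of such $C$ is $\mathrm{Lip}_\alpha(f)$, and $\mathrm{Lip}_\alpha(X,E^* )$ is the set of all such maps, a normed space under $\mathrm{Lip}_\alpha$. For $g\in X^\#$, $\phi\in E^*$, $g\boxtimes\phi$ is the linear functional on $X\boxtimes E$ given by $(g\boxtimes\phi)\left(\sum_i\delta_{(x_i,y_i)}\boxtimes e_i\right)=\sum_i(g(x_i)-g(y_i))\langle\phi,e_i\rangle$. The associated Lipschitz tensor product, here denoted $X^\#\boxdot E^*$, is the linear span of all such functionals $g\boxtimes\phi$. The associated Lipschitz norm $\alpha'$ of $\alpha$ is the norm on $X^\#\boxdot E^*$ given by $\alpha'(v)=\sup\{|v(u)|\colon u\in X\boxtimes E,\ \alpha(u)\le1\}$; $X^\#\boxdot_{\alpha'}E^*$ denotes $X^\#\boxdot E^*$ with this norm. For $g\in X^\#$ and $\phi\in E^*$, $g\cdot\phi\colon X\to E^*$ is the map $(g\cdot\phi)(x)=g(x)\phi$. $\mathrm{Lip}_{0F}(X,E^* )$ is the space of $f\in\mathrm{Lip}_0(X,E^* )$ for which the linear span of $f(X)$ is finite dimensional (for dualizable $\alpha$ it is contained in $\mathrm{Lip}_\alpha(X,E^* )$). An operator $f\in\mathrm{Lip}_\alpha(X,E^* )$ is $\alpha$-Lipschitz approximable if it is the limit in the norm $\mathrm{Lip}_\alpha$ of a sequence in $\mathrm{Lip}_{0F}(X,E^* )$. *)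

theory Defs
  imports "HOL-Analysis.Analysis" "HOL-Library.Function_Algebras"
begin

text \<open>
  The scalar field is a type of sort \<open>{real_normed_field, banach}\<close>. A normed field
  over the reals (with multiplicative norm) is isometrically isomorphic to the reals or to the
  complex numbers by the Gelfand--Mazur theorem, so this sort stands for exactly these two fields,
  and both are instances of it.

  A Banach space over the scalar field \<open>'k\<close> is a type of class \<open>banach\<close> (which gives the
  underlying real Banach space) together with a scalar multiplication by \<open>'k\<close> for which the given
  norm is homogeneous. The last assumption says that the real scalar multiplication of the type is
  the restriction of that of \<open>'k\<close>.
\<close>

locale banach_over = vector_space smul
  for smul :: "'k::{real_normed_field,banach} \<Rightarrow> 'e::banach \<Rightarrow> 'e" +
  assumes norm_scale: "norm (smul c e) = norm c * norm e"
    and scale_of_real: "smul (of_real r) e = r *\<^sub>R e"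


section \<open>Normed spaces as structures, isometric isomorphisms, completions\<close>

text \<open>All spaces below are subsets of function types (or, for the completion, of a type of sets),
  so they are recorded together with their operations.\<close>

record ('k, 'v) nspace =
  ns_carrier :: "'v set"
  ns_add :: "'v \<Rightarrow> 'v \<Rightarrow> 'v"
  ns_scale :: "'k \<Rightarrow> 'v \<Rightarrow> 'v"
  ns_norm :: "'v \<Rightarrow> real"

definition isometric_isomorphism ::
  "('v \<Rightarrow> 'w) \<Rightarrow> ('k, 'v) nspace \<Rightarrow> ('k, 'w) nspace \<Rightarrow> bool" where
  "isometric_isomorphism T V W \<longleftrightarrow>
     bij_betw T (ns_carrier V) (ns_carrier W) \<and>
     (\<forall>u\<in>ns_carrier V. \<forall>v\<in>ns_carrier V. T (ns_add V u v) = ns_add W (T u) (T v)) \<and>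
     (\<forall>c. \<forall>u\<in>ns_carrier V. T (ns_scale V c u) = ns_scale W c (T u)) \<and>
     (\<forall>u\<in>ns_carrier V. ns_norm W (T u) = ns_norm V u)"

definition isometrically_isomorphic :: "('k, 'v) nspace \<Rightarrow> ('k, 'w) nspace \<Rightarrow> bool" where
  "isometrically_isomorphic V W \<longleftrightarrow> (\<exists>T. isometric_isomorphism T V W)"

definition ns_dist :: "('k::ring_1, 'v) nspace \<Rightarrow> 'v \<Rightarrow> 'v \<Rightarrow> real" where
  "ns_dist V u v = ns_norm V (ns_add V u (ns_scale V (- 1) v))"

definition ns_Cauchy_seqs :: "('k::ring_1, 'v) nspace \<Rightarrow> (nat \<Rightarrow> 'v) set" where
  "ns_Cauchy_seqs V = {s. range s \<subseteq> ns_carrier V \<and>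
     (\<forall>\<epsilon>>0. \<exists>M. \<forall>m\<ge>M. \<forall>n\<ge>M. ns_dist V (s m) (s n) < \<epsilon>)}"

definition ns_Cauchy_rel :: "('k::ring_1, 'v) nspace \<Rightarrow> ((nat \<Rightarrow> 'v) \<times> (nat \<Rightarrow> 'v)) set" where
  "ns_Cauchy_rel V = {(s, t). s \<in> ns_Cauchy_seqs V \<and> t \<in> ns_Cauchy_seqs V \<and>
     (\<lambda>n. ns_dist V (s n) (t n)) \<longlonglongrightarrow> 0}"

text \<open>The completion: Cauchy sequences modulo null sequences, with termwise operations and the
  limit of the norms as norm.\<close>

definition ns_completion :: "('k::ring_1, 'v) nspace \<Rightarrow> ('k, (nat \<Rightarrow> 'v) set) nspace" where
  "ns_completion V =
     \<lparr> ns_carrier = ns_Cauchy_seqs V // ns_Cauchy_rel V,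
       ns_add = (\<lambda>A B. \<Union>s\<in>A. \<Union>t\<in>B. ns_Cauchy_rel V `` {\<lambda>n. ns_add V (s n) (t n)}),
       ns_scale = (\<lambda>c A. \<Union>s\<in>A. ns_Cauchy_rel V `` {\<lambda>n. ns_scale V c (s n)}),
       ns_norm = (\<lambda>A. THE r. \<forall>s\<in>A. (\<lambda>n. ns_norm V (s n)) \<longlonglongrightarrow> r) \<rparr>"


section \<open>Dual space and spaces of Lipschitz maps\<close>

text \<open>The dual of \<open>E\<close> sits inside the type of real-linear bounded maps \<open>'e \<Rightarrow>\<^sub>L 'k\<close>; the norm of
  that type is the operator norm, which does not depend on the scalars.\<close>

definition dual_space ::
  "('k::{real_normed_field,banach} \<Rightarrow> 'e::banach \<Rightarrow> 'e) \<Rightarrow> ('e \<Rightarrow>\<^sub>L 'k) set" where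
  "dual_space smul = {\<phi>. \<forall>c e. blinfun_apply \<phi> (smul c e) = c * blinfun_apply \<phi> e}"

definition dual_scale ::
  "'k::{real_normed_field,banach} \<Rightarrow> ('e::banach \<Rightarrow>\<^sub>L 'k) \<Rightarrow> ('e \<Rightarrow>\<^sub>L 'k)" where
  "dual_scale c \<phi> = blinfun_mult_right c o\<^sub>L \<phi>"

lemma dual_scale_apply: "blinfun_apply (dual_scale c \<phi>) e = c * blinfun_apply \<phi> e"
  by (simp add: dual_scale_def blinfun_mult_right.rep_eq)

definition map_scale ::
  "'k::{real_normed_field,banach} \<Rightarrow> ('x \<Rightarrow> ('e::banach \<Rightarrow>\<^sub>L 'k)) \<Rightarrow> ('x \<Rightarrow> ('e \<Rightarrow>\<^sub>L 'k))" where
  "map_scale c f = (\<lambda>x. dual_scale c (f x))"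

definition fun_scale :: "'k::field \<Rightarrow> ('a \<Rightarrow> 'k) \<Rightarrow> ('a \<Rightarrow> 'k)" where
  "fun_scale c u = (\<lambda>f. c * u f)"

text \<open>Throughout, \<open>z\<close> is the base point of \<open>X\<close>, and \<open>X\<close> is the whole type \<open>'x\<close>.\<close>

definition lip_sharp :: "'x::metric_space \<Rightarrow> ('x \<Rightarrow> 'k::{real_normed_field,banach}) set" where
  "lip_sharp z = {g. g z = 0 \<and> (\<exists>L. L-lipschitz_on UNIV g)}"

definition Lip :: "('x::metric_space \<Rightarrow> 'b::metric_space) \<Rightarrow> real" where
  "Lip g = Inf {L. L-lipschitz_on UNIV g}"

definition lip0_dual :: "('k::{real_normed_field,banach} \<Rightarrow> 'e::banach \<Rightarrow> 'e) \<Rightarrow>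
    'x::metric_space \<Rightarrow> ('x \<Rightarrow> ('e \<Rightarrow>\<^sub>L 'k)) set" where
  "lip0_dual smul z =
     {f. range f \<subseteq> dual_space smul \<and> f z = 0 \<and> (\<exists>L. L-lipschitz_on UNIV f)}"

definition lip0F :: "('k::{real_normed_field,banach} \<Rightarrow> 'e::banach \<Rightarrow> 'e) \<Rightarrow>
    'x::metric_space \<Rightarrow> ('x \<Rightarrow> ('e \<Rightarrow>\<^sub>L 'k)) set" where
  "lip0F smul z = {f \<in> lip0_dual smul z.
     \<exists>B. finite B \<and> module.span dual_scale B = module.span dual_scale (range f)}"


section \<open>The Lipschitz tensor product and Lipschitz cross-norms\<close>

text \<open>The functionals are defined on the set \<open>lip0_dual smul z\<close> only; they are extended by \<open>0\<close>
  to the whole type so that equality of functions is equality on that set.\<close>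

definition delta :: "('k::{real_normed_field,banach} \<Rightarrow> 'e::banach \<Rightarrow> 'e) \<Rightarrow>
    'x::metric_space \<Rightarrow> 'x \<Rightarrow> 'x \<Rightarrow> 'e \<Rightarrow> (('x \<Rightarrow> ('e \<Rightarrow>\<^sub>L 'k)) \<Rightarrow> 'k)" where
  "delta smul z x y e =
     (\<lambda>f. if f \<in> lip0_dual smul z then blinfun_apply (f x - f y) e else 0)"

definition lip_tensor :: "('k::{real_normed_field,banach} \<Rightarrow> 'e::banach \<Rightarrow> 'e) \<Rightarrow>
    'x::metric_space \<Rightarrow> (('x \<Rightarrow> ('e \<Rightarrow>\<^sub>L 'k)) \<Rightarrow> 'k) set" where
  "lip_tensor smul z = module.span fun_scale {delta smul z x y e | x y e. True}"

definition lip_cross_norm :: "('k::{real_normed_field,banach} \<Rightarrow> 'e::banach \<Rightarrow> 'e) \<Rightarrow>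
    'x::metric_space \<Rightarrow> ((('x \<Rightarrow> ('e \<Rightarrow>\<^sub>L 'k)) \<Rightarrow> 'k) \<Rightarrow> real) \<Rightarrow> bool" where
  "lip_cross_norm smul z \<alpha> \<longleftrightarrow>
     (\<forall>u\<in>lip_tensor smul z. 0 \<le> \<alpha> u \<and> (\<alpha> u = 0 \<longleftrightarrow> u = 0)) \<and>
     (\<forall>c. \<forall>u\<in>lip_tensor smul z. \<alpha> (fun_scale c u) = norm c * \<alpha> u) \<and>
     (\<forall>u\<in>lip_tensor smul z. \<forall>v\<in>lip_tensor smul z. \<alpha> (u + v) \<le> \<alpha> u + \<alpha> v) \<and>
     (\<forall>x y e. \<alpha> (delta smul z x y e) = dist x y * norm e)"

definition dualizable :: "('k::{real_normed_field,banach} \<Rightarrow> 'e::banach \<Rightarrow> 'e) \<Rightarrow>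
    'x::metric_space \<Rightarrow> ((('x \<Rightarrow> ('e \<Rightarrow>\<^sub>L 'k)) \<Rightarrow> 'k) \<Rightarrow> real) \<Rightarrow> bool" where
  "dualizable smul z \<alpha> \<longleftrightarrow>
     (\<forall>g\<in>lip_sharp z. \<forall>\<phi>\<in>dual_space smul. \<forall>(n::nat) x y e.
        norm (\<Sum>i<n. (g (x i) - g (y i)) * blinfun_apply \<phi> (e i))
          \<le> Lip g * norm \<phi> * \<alpha> (\<Sum>i<n. delta smul z (x i) (y i) (e i)))"


section \<open>\<open>\<alpha>\<close>-Lipschitz operators\<close>

definition lip_alpha_bound :: "('k::{real_normed_field,banach} \<Rightarrow> 'e::banach \<Rightarrow> 'e) \<Rightarrow>
    'x::metric_space \<Rightarrow> ((('x \<Rightarrow> ('e \<Rightarrow>\<^sub>L 'k)) \<Rightarrow> 'k) \<Rightarrow> real) \<Rightarrow> ('x \<Rightarrow> ('e \<Rightarrow>\<^sub>L 'k)) \<Rightarrow>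
    real \<Rightarrow> bool" where
  "lip_alpha_bound smul z \<alpha> f C \<longleftrightarrow> C \<ge> 0 \<and>
     (\<forall>(n::nat) x y e. norm (\<Sum>i<n. blinfun_apply (f (x i) - f (y i)) (e i))
        \<le> C * \<alpha> (\<Sum>i<n. delta smul z (x i) (y i) (e i)))"

definition lip_alpha :: "('k::{real_normed_field,banach} \<Rightarrow> 'e::banach \<Rightarrow> 'e) \<Rightarrow>
    'x::metric_space \<Rightarrow> ((('x \<Rightarrow> ('e \<Rightarrow>\<^sub>L 'k)) \<Rightarrow> 'k) \<Rightarrow> real) \<Rightarrow> ('x \<Rightarrow> ('e \<Rightarrow>\<^sub>L 'k)) set" where
  "lip_alpha smul z \<alpha> =
     {f. range f \<subseteq> dual_space smul \<and> f z = 0 \<and> (\<exists>C. lip_alpha_bound smul z \<alpha> f C)}"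

definition Lip_alpha :: "('k::{real_normed_field,banach} \<Rightarrow> 'e::banach \<Rightarrow> 'e) \<Rightarrow>
    'x::metric_space \<Rightarrow> ((('x \<Rightarrow> ('e \<Rightarrow>\<^sub>L 'k)) \<Rightarrow> 'k) \<Rightarrow> real) \<Rightarrow> ('x \<Rightarrow> ('e \<Rightarrow>\<^sub>L 'k)) \<Rightarrow> real" where
  "Lip_alpha smul z \<alpha> f = Inf {C. lip_alpha_bound smul z \<alpha> f C}"

definition lip_approximable :: "('k::{real_normed_field,banach} \<Rightarrow> 'e::banach \<Rightarrow> 'e) \<Rightarrow>
    'x::metric_space \<Rightarrow> ((('x \<Rightarrow> ('e \<Rightarrow>\<^sub>L 'k)) \<Rightarrow> 'k) \<Rightarrow> real) \<Rightarrow> ('x \<Rightarrow> ('e \<Rightarrow>\<^sub>L 'k)) set" where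
  "lip_approximable smul z \<alpha> = {f \<in> lip_alpha smul z \<alpha>.
     \<exists>h. (\<forall>n::nat. h n \<in> lip0F smul z) \<and> (\<lambda>n. Lip_alpha smul z \<alpha> (h n - f)) \<longlonglongrightarrow> 0}"

definition lip0F_space :: "('k::{real_normed_field,banach} \<Rightarrow> 'e::banach \<Rightarrow> 'e) \<Rightarrow>
    'x::metric_space \<Rightarrow> ((('x \<Rightarrow> ('e \<Rightarrow>\<^sub>L 'k)) \<Rightarrow> 'k) \<Rightarrow> real) \<Rightarrow> ('k, 'x \<Rightarrow> ('e \<Rightarrow>\<^sub>L 'k)) nspace" where
  "lip0F_space smul z \<alpha> =
     \<lparr> ns_carrier = lip0F smul z, ns_add = (+), ns_scale = map_scale,
       ns_norm = Lip_alpha smul z \<alpha> \<rparr>"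

definition lip_approximable_space :: "('k::{real_normed_field,banach} \<Rightarrow> 'e::banach \<Rightarrow> 'e) \<Rightarrow>
    'x::metric_space \<Rightarrow> ((('x \<Rightarrow> ('e \<Rightarrow>\<^sub>L 'k)) \<Rightarrow> 'k) \<Rightarrow> real) \<Rightarrow> ('k, 'x \<Rightarrow> ('e \<Rightarrow>\<^sub>L 'k)) nspace" where
  "lip_approximable_space smul z \<alpha> =
     \<lparr> ns_carrier = lip_approximable smul z \<alpha>, ns_add = (+), ns_scale = map_scale,
       ns_norm = Lip_alpha smul z \<alpha> \<rparr>"


section \<open>The associated Lipschitz tensor product and the associated norm\<close>

text \<open>The value on \<open>u\<close> is read off from any representation of \<open>u\<close> as a sum of functionals
  \<open>delta\<close>; the lemma \<open>assoc_fun_sum\<close> below shows that it does not depend on the representation.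
  As above, the functional is extended by \<open>0\<close> outside its domain.\<close>

definition assoc_fun :: "('k::{real_normed_field,banach} \<Rightarrow> 'e::banach \<Rightarrow> 'e) \<Rightarrow>
    'x::metric_space \<Rightarrow> ('x \<Rightarrow> 'k) \<Rightarrow> ('e \<Rightarrow>\<^sub>L 'k) \<Rightarrow> ((('x \<Rightarrow> ('e \<Rightarrow>\<^sub>L 'k)) \<Rightarrow> 'k) \<Rightarrow> 'k)" where
  "assoc_fun smul z g \<phi> = (\<lambda>u. if u \<in> lip_tensor smul z
     then THE t. \<exists>(n::nat) x y e. u = (\<Sum>i<n. delta smul z (x i) (y i) (e i)) \<and>
            t = (\<Sum>i<n. (g (x i) - g (y i)) * blinfun_apply \<phi> (e i))
     else 0)"

definition assoc_tensor :: "('k::{real_normed_field,banach} \<Rightarrow> 'e::banach \<Rightarrow> 'e) \<Rightarrow>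
    'x::metric_space \<Rightarrow> ((('x \<Rightarrow> ('e \<Rightarrow>\<^sub>L 'k)) \<Rightarrow> 'k) \<Rightarrow> 'k) set" where
  "assoc_tensor smul z = module.span fun_scale
     {assoc_fun smul z g \<phi> | g \<phi>. g \<in> lip_sharp z \<and> \<phi> \<in> dual_space smul}"

definition assoc_norm :: "('k::{real_normed_field,banach} \<Rightarrow> 'e::banach \<Rightarrow> 'e) \<Rightarrow>
    'x::metric_space \<Rightarrow> ((('x \<Rightarrow> ('e \<Rightarrow>\<^sub>L 'k)) \<Rightarrow> 'k) \<Rightarrow> real) \<Rightarrow>
    ((('x \<Rightarrow> ('e \<Rightarrow>\<^sub>L 'k)) \<Rightarrow> 'k) \<Rightarrow> 'k) \<Rightarrow> real" where
  "assoc_norm smul z \<alpha> v = Sup {norm (v u) | u. u \<in> lip_tensor smul z \<and> \<alpha> u \<le> 1}"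

definition assoc_space :: "('k::{real_normed_field,banach} \<Rightarrow> 'e::banach \<Rightarrow> 'e) \<Rightarrow>
    'x::metric_space \<Rightarrow> ((('x \<Rightarrow> ('e \<Rightarrow>\<^sub>L 'k)) \<Rightarrow> 'k) \<Rightarrow> real) \<Rightarrow>
    ('k, (('x \<Rightarrow> ('e \<Rightarrow>\<^sub>L 'k)) \<Rightarrow> 'k) \<Rightarrow> 'k) nspace" where
  "assoc_space smul z \<alpha> =
     \<lparr> ns_carrier = assoc_tensor smul z, ns_add = (+), ns_scale = fun_scale,
       ns_norm = assoc_norm smul z \<alpha> \<rparr>"

definition lip_dot :: "('x \<Rightarrow> 'k::{real_normed_field,banach}) \<Rightarrow> ('e::banach \<Rightarrow>\<^sub>L 'k) \<Rightarrow>
    ('x \<Rightarrow> ('e \<Rightarrow>\<^sub>L 'k))" where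
  "lip_dot g \<phi> = (\<lambda>x. dual_scale (g x) \<phi>)"

lemma lip_dot_in_lip0_dual:
  assumes "g \<in> lip_sharp z" "\<phi> \<in> dual_space smul"
  shows "lip_dot g \<phi> \<in> lip0_dual smul z"
proof -
  from assms obtain L where L: "L-lipschitz_on UNIV g" and gz: "g z = 0"
    unfolding lip_sharp_def by blast
  have "(L * norm \<phi>)-lipschitz_on UNIV (lip_dot g \<phi>)"
  proof (rule lipschitz_onI)
    fix x y
    have "dist (lip_dot g \<phi> x) (lip_dot g \<phi> y) = norm (dual_scale (g x - g y) \<phi>)"
      unfolding dist_norm lip_dot_def
      by (rule arg_cong[where f = norm], rule blinfun_eqI)
        (simp add: dual_scale_apply blinfun.diff_left algebra_simps)
    also have "\<dots> \<le> norm (g x - g y) * norm \<phi>"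
      by (rule norm_blinfun_bound)
        (auto simp: dual_scale_apply norm_mult mult.assoc intro!: mult_left_mono norm_blinfun)
    also have "\<dots> \<le> (L * dist x y) * norm \<phi>"
      using lipschitz_onD[OF L, of x y] by (intro mult_right_mono) (auto simp: dist_norm)
    finally show "dist (lip_dot g \<phi> x) (lip_dot g \<phi> y) \<le> L * norm \<phi> * dist x y"
      by (simp add: mult_ac)
  next
    show "0 \<le> L * norm \<phi>" using lipschitz_on_nonneg[OF L] by simp
  qed
  moreover have "lip_dot g \<phi> z = 0"
    by (rule blinfun_eqI) (simp add: lip_dot_def dual_scale_apply gz)
  moreover have "range (lip_dot g \<phi>) \<subseteq> dual_space smul"
    using assms(2) by (auto simp: dual_space_def lip_dot_def dual_scale_apply mult_ac)
  ultimately show ?thesis unfolding lip0_dual_def by blast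
qed

lemma sum_fun_apply: "(\<Sum>i<n. h i) f = (\<Sum>i<n. h i f)" for h :: "nat \<Rightarrow> 'a \<Rightarrow> 'b::comm_monoid_add"
  by (induction n) auto

lemma assoc_fun_sum:
  fixes smul :: "'k::{real_normed_field,banach} \<Rightarrow> 'e::banach \<Rightarrow> 'e" and z :: "'x::metric_space"
    and n :: nat
  assumes "g \<in> lip_sharp z" "\<phi> \<in> dual_space smul"
  shows "assoc_fun smul z g \<phi> (\<Sum>i<n. delta smul z (x i) (y i) (e i)) =
    (\<Sum>i<n. (g (x i) - g (y i)) * blinfun_apply \<phi> (e i))"
proof -
  interpret m: module "fun_scale :: 'k \<Rightarrow> (('x \<Rightarrow> ('e \<Rightarrow>\<^sub>L 'k)) \<Rightarrow> 'k) \<Rightarrow> _"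
    by unfold_locales (auto simp: fun_scale_def algebra_simps fun_eq_iff)
  have mem: "(\<Sum>i<n. delta smul z (x i) (y i) (e i)) \<in> lip_tensor smul z"
    unfolding lip_tensor_def by (intro m.span_sum m.span_base) blast
  have val: "(\<Sum>i<N. delta smul z (X i) (Y i) (V i)) (lip_dot g \<phi>) =
    (\<Sum>i<N. (g (X i) - g (Y i)) * blinfun_apply \<phi> (V i))" for N :: nat and X Y V
    using lip_dot_in_lip0_dual[OF assms]
    by (simp add: sum_fun_apply delta_def blinfun.diff_left lip_dot_def dual_scale_apply
        left_diff_distrib)
  show ?thesis
    unfolding assoc_fun_def using mem val
    by (simp, intro the_equality) (metis (no_types, lifting))+
qed

end

theory Submission
  imports Defs
begin

text \<open>
  An element \<open>u\<close> of the Lipschitz tensor product is a functional on Lipschitz maps \<open>X \<rightarrow> E\<^sup>*\<close>, so a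
  Lipschitz map \<open>f\<close> acts on the tensor product by evaluation, \<open>u \<mapsto> u f\<close> (the function
  \<open>tensor_eval\<close>). Evaluation at \<open>g \<cdot> \<phi>\<close> is the functional \<open>g \<boxtimes> \<phi>\<close>
  (\<open>tensor_eval_lip_dot\<close>), and evaluation determines \<open>f\<close>, because the tensors based at the base
  point read off all the values \<open>f x e\<close> (\<open>tensor_eval_inj\<close>). The map \<open>K\<close> is the inverse of
  evaluation, which is linear and well defined without any choice of representations.

  Three facts make evaluation an isometric isomorphism from the finite-rank maps onto the associated
  tensor product. The finite-rank maps are exactly the linear combinations of maps \<open>g \<cdot> \<phi>\<close>
  (\<open>lip0F_eq_span_lip_dot\<close>). Dualizability places these maps in the space of \<open>\<alpha>\<close>-Lipschitz
  operators (\<open>lip_dot_in_lip_alpha\<close>). Finally \<open>Lip\<^sub>\<alpha>(f)\<close> is the least \<open>C\<close> with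
  \<open>|u f| \<le> C \<alpha>(u)\<close>, so it is the operator norm of evaluation at \<open>f\<close>
  (\<open>assoc_norm_tensor_eval\<close>).

  For the approximable operators, the space of all \<open>\<alpha>\<close>-Lipschitz operators is complete
  (\<open>lip_alpha_complete\<close>): the cross-norm property bounds \<open>\<parallel>f x - f y\<parallel>\<close> by
  \<open>Lip\<^sub>\<alpha>(f) d(x, y)\<close>, so Cauchy sequences converge pointwise, and their defining inequalities pass
  to the limit. The approximable operators are the closure of the finite-rank maps in this complete
  space, and such a closure is a model of the completion (\<open>closure_iso_completion\<close>).
\<close>

section \<open>Closures in complete normed spaces and completions\<close>

lemma null_squeeze:
  fixes a b :: "nat \<Rightarrow> real"
  assumes "b \<longlonglongrightarrow> 0" "\<And>n. a n \<le> b n" "\<And>n. 0 \<le> a n"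
  shows "a \<longlonglongrightarrow> 0"
  by (rule tendsto_sandwich[OF _ _ tendsto_const assms(1)]) (simp_all add: assms(2,3))

text \<open>The closure assumptions place \<open>T\<inverse> u + T\<inverse> v\<close> and \<open>c T\<inverse> u\<close> in the domain on which \<open>T\<close> is
  injective; a record of type \<open>nspace\<close> does not guarantee this.\<close>

lemma isometric_isomorphism_inv_into:
  assumes T: "isometric_isomorphism T V W"
    and add: "\<And>u v. u \<in> ns_carrier V \<Longrightarrow> v \<in> ns_carrier V \<Longrightarrow> ns_add V u v \<in> ns_carrier V"
    and scale: "\<And>c u. u \<in> ns_carrier V \<Longrightarrow> ns_scale V c u \<in> ns_carrier V"
  shows "isometric_isomorphism (inv_into (ns_carrier V) T) W V"
proof -
  let ?R = "inv_into (ns_carrier V) T"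
  have bij: "bij_betw T (ns_carrier V) (ns_carrier W)"
    using T by (simp add: isometric_isomorphism_def)
  have R: "?R w \<in> ns_carrier V" "T (?R w) = w" if "w \<in> ns_carrier W" for w
    using that bij by (auto simp: bij_betw_def inv_into_into f_inv_into_f)
  have RT: "?R (T v) = v" if "v \<in> ns_carrier V" for v
    using that bij by (simp add: bij_betw_def)
  show ?thesis
    unfolding isometric_isomorphism_def
  proof (intro conjI ballI allI)
    show "bij_betw ?R (ns_carrier W) (ns_carrier V)"
      using bij by (rule bij_betw_inv_into)
  next
    fix u v assume uv: "u \<in> ns_carrier W" "v \<in> ns_carrier W"
    have "T (ns_add V (?R u) (?R v)) = ns_add W u v"
      using T R uv by (simp add: isometric_isomorphism_def)
    then show "?R (ns_add W u v) = ns_add V (?R u) (?R v)"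
      using RT[OF add[OF R(1)[OF uv(1)] R(1)[OF uv(2)]]] by simp
  next
    fix c u assume u: "u \<in> ns_carrier W"
    have "T (ns_scale V c (?R u)) = ns_scale W c u"
      using T R u by (simp add: isometric_isomorphism_def)
    then show "?R (ns_scale W c u) = ns_scale V c (?R u)"
      using RT[OF scale[OF R(1)[OF u]]] by metis
  next
    fix u assume u: "u \<in> ns_carrier W"
    then show "ns_norm V (?R u) = ns_norm W u"
      using T R[OF u] unfolding isometric_isomorphism_def by metis
  qed
qed

text \<open>The norm is required to behave well on \<open>A\<close> only: the norms of interest, such as \<open>Lip_alpha\<close>,
  are infima or suprema that have no meaning for arbitrary functions.\<close>

locale normed_subspace = module sc
  for sc :: "'k::real_normed_field \<Rightarrow> 'w::ab_group_add \<Rightarrow> 'w" +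
  fixes A :: "'w set" and N :: "'w \<Rightarrow> real"
  assumes sub: "subspace A"
    and N_nonneg: "f \<in> A \<Longrightarrow> 0 \<le> N f"
    and N_eq_0: "f \<in> A \<Longrightarrow> N f = 0 \<Longrightarrow> f = 0"
    and N_scale: "f \<in> A \<Longrightarrow> N (sc c f) = norm c * N f"
    and N_triangle: "f \<in> A \<Longrightarrow> g \<in> A \<Longrightarrow> N (f + g) \<le> N f + N g"
begin

lemma N_minus: "f \<in> A \<Longrightarrow> N (- f) = N f"
  using N_scale[of f "- 1"] by simp

lemma N_diff_commute: "f \<in> A \<Longrightarrow> g \<in> A \<Longrightarrow> N (f - g) = N (g - f)"
  using N_minus[of "f - g"] subspace_diff[OF sub] by simp

lemma N_dist_triangle:
  assumes "f \<in> A" "g \<in> A" "h \<in> A"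
  shows "N (f - h) \<le> N (f - g) + N (g - h)"
  using N_triangle[of "f - g" "g - h"] assms subspace_diff[OF sub] by simp

lemma N_reverse_triangle:
  assumes "f \<in> A" "g \<in> A"
  shows "\<bar>N f - N g\<bar> \<le> N (f - g)"
  using N_triangle[of "f - g" g] N_triangle[of "g - f" f] N_diff_commute[OF assms]
    assms subspace_diff[OF sub] by (simp add: abs_le_iff)

lemma limit_unique:
  assumes A: "range s \<subseteq> A" "f \<in> A" "g \<in> A"
    and f: "(\<lambda>n. N (s n - f)) \<longlonglongrightarrow> 0" and g: "(\<lambda>n. N (s n - g)) \<longlonglongrightarrow> 0"
  shows "f = g"
proof -
  have "(\<lambda>n. N (s n - f) + N (s n - g)) \<longlonglongrightarrow> 0"
    using tendsto_add[OF f g] by simp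
  moreover have "N (f - g) \<le> N (s n - f) + N (s n - g)" for n
    using N_dist_triangle[of f "s n" g] N_diff_commute[of f "s n"] A by auto
  ultimately have "N (f - g) \<le> 0"
    by (intro LIMSEQ_le_const) auto
  then have "N (f - g) = 0"
    using N_nonneg[of "f - g"] subspace_diff[OF sub] A by fastforce
  then show ?thesis
    using N_eq_0[of "f - g"] subspace_diff[OF sub] A by simp
qed

text \<open>A point \<open>f\<close> of the closure corresponds to the set \<open>\<Phi> f\<close> of all sequences in \<open>V\<close> whose images
  converge to \<open>f\<close>. This set is a full equivalence class of Cauchy sequences, since two sequences
  with a common limit have distance tending to zero and conversely; limits being unique, \<open>\<Phi>\<close> is
  injective, and completeness makes it surjective.\<close>

lemma closure_iso_completion:
  fixes V :: "('k, 'v) nspace"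
  assumes complete: "\<And>s. range s \<subseteq> A \<Longrightarrow>
        (\<forall>\<epsilon>>0. \<exists>M. \<forall>m\<ge>M. \<forall>n\<ge>M. N (s m - s n) < \<epsilon>) \<Longrightarrow> \<exists>f\<in>A. (\<lambda>n. N (s n - f)) \<longlonglongrightarrow> 0"
    and S: "S \<subseteq> A"
    and K: "isometric_isomorphism K V
        \<lparr> ns_carrier = S, ns_add = (+), ns_scale = sc, ns_norm = N \<rparr>"
    and add: "\<And>u v. u \<in> ns_carrier V \<Longrightarrow> v \<in> ns_carrier V \<Longrightarrow> ns_add V u v \<in> ns_carrier V"
    and scale: "\<And>c u. u \<in> ns_carrier V \<Longrightarrow> ns_scale V c u \<in> ns_carrier V"
  shows "isometrically_isomorphic
      \<lparr> ns_carrier = {f \<in> A. \<exists>h. (\<forall>n::nat. h n \<in> S) \<and> (\<lambda>n. N (h n - f)) \<longlonglongrightarrow> 0},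
        ns_add = (+), ns_scale = sc, ns_norm = N \<rparr>
      (ns_completion V)"
proof -
  let ?C = "{f \<in> A. \<exists>h. (\<forall>n::nat. h n \<in> S) \<and> (\<lambda>n. N (h n - f)) \<longlonglongrightarrow> 0}"
  define \<Phi> where "\<Phi> f = {s. range s \<subseteq> ns_carrier V \<and> (\<lambda>n. N (K (s n) - f)) \<longlonglongrightarrow> 0}" for f
  have bij: "bij_betw K (ns_carrier V) S"
    and K_add: "\<And>u v. u \<in> ns_carrier V \<Longrightarrow> v \<in> ns_carrier V \<Longrightarrow> K (ns_add V u v) = K u + K v"
    and K_scale: "\<And>c u. u \<in> ns_carrier V \<Longrightarrow> K (ns_scale V c u) = sc c (K u)"
    and K_norm: "\<And>u. u \<in> ns_carrier V \<Longrightarrow> N (K u) = ns_norm V u"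
    using K by (auto simp: isometric_isomorphism_def)
  have KA: "K u \<in> A" if "u \<in> ns_carrier V" for u
    using that bij S by (auto simp: bij_betw_def)
  have dist: "ns_dist V u v = N (K u - K v)" if "u \<in> ns_carrier V" "v \<in> ns_carrier V" for u v
    using that by (simp add: ns_dist_def K_norm[symmetric] add scale K_add K_scale)

  \<comment> \<open>A class of the completion is handled through any one of its members, so the following facts are
    about a single \<open>s \<in> \<Phi> f\<close>.\<close>
  have Cauchy_if: "s \<in> ns_Cauchy_seqs V" if s: "s \<in> \<Phi> f" and f: "f \<in> A" for s f
    unfolding ns_Cauchy_seqs_def
  proof (intro CollectI conjI allI impI)
    show ran: "range s \<subseteq> ns_carrier V" using s by (simp add: \<Phi>_def)
    fix \<epsilon> :: real assume "\<epsilon> > 0"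
    have "(\<lambda>n. N (K (s n) - f)) \<longlonglongrightarrow> 0" using s by (simp add: \<Phi>_def)
    then have "\<forall>\<^sub>F n in sequentially. N (K (s n) - f) < \<epsilon> / 2"
      using \<open>\<epsilon> > 0\<close> by (intro order_tendstoD(2)) auto
    then obtain M where M: "\<And>n. n \<ge> M \<Longrightarrow> N (K (s n) - f) < \<epsilon> / 2"
      by (auto simp: eventually_sequentially)
    have "ns_dist V (s m) (s n) < \<epsilon>" if "m \<ge> M" "n \<ge> M" for m n
    proof -
      have in_V: "s m \<in> ns_carrier V" "s n \<in> ns_carrier V" using ran by auto
      show ?thesis
        using N_dist_triangle[OF KA[OF in_V(1)] f KA[OF in_V(2)]]
          N_diff_commute[OF f KA[OF in_V(2)]] M[OF that(1)] M[OF that(2)]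
        by (simp add: dist in_V)
    qed
    then show "\<exists>M. \<forall>m\<ge>M. \<forall>n\<ge>M. ns_dist V (s m) (s n) < \<epsilon>" by blast
  qed

  have coset: "ns_Cauchy_rel V `` {s} = \<Phi> f" if s: "s \<in> \<Phi> f" and f: "f \<in> A" for s f
  proof (intro set_eqI iffI)
    fix t assume "t \<in> ns_Cauchy_rel V `` {s}"
    then have t: "range t \<subseteq> ns_carrier V" and st: "(\<lambda>n. ns_dist V (s n) (t n)) \<longlonglongrightarrow> 0"
      by (auto simp: ns_Cauchy_rel_def ns_Cauchy_seqs_def)
    have in_V: "s n \<in> ns_carrier V" "t n \<in> ns_carrier V" for n
      using s t by (auto simp: \<Phi>_def)
    have sf: "(\<lambda>n. N (K (s n) - f)) \<longlonglongrightarrow> 0"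
      using s by (simp add: \<Phi>_def)
    have "(\<lambda>n. ns_dist V (s n) (t n) + N (K (s n) - f)) \<longlonglongrightarrow> 0"
      using tendsto_add[OF st sf] by simp
    moreover have "N (K (t n) - f) \<le> ns_dist V (s n) (t n) + N (K (s n) - f)" for n
      using N_dist_triangle[of "K (t n)" "K (s n)" f] N_diff_commute[of "K (t n)" "K (s n)"]
      by (simp add: dist in_V KA f)
    moreover have "0 \<le> N (K (t n) - f)" for n
      by (intro N_nonneg subspace_diff[OF sub] KA in_V f)
    ultimately have "(\<lambda>n. N (K (t n) - f)) \<longlonglongrightarrow> 0"
      by (rule null_squeeze)
    then show "t \<in> \<Phi> f" using t by (simp add: \<Phi>_def)
  next
    fix t assume t: "t \<in> \<Phi> f"
    have in_V: "s n \<in> ns_carrier V" "t n \<in> ns_carrier V" for n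
      using s t by (auto simp: \<Phi>_def)
    have "(\<lambda>n. N (K (s n) - f) + N (K (t n) - f)) \<longlonglongrightarrow> 0"
      using s t unfolding \<Phi>_def by (intro tendsto_add_zero) blast+
    moreover have "N (K (s n) - K (t n)) \<le> N (K (s n) - f) + N (K (t n) - f)" for n
      using N_dist_triangle[of "K (s n)" f "K (t n)"] N_diff_commute[of f "K (t n)"]
      by (simp add: in_V KA f)
    moreover have "0 \<le> N (K (s n) - K (t n))" for n
      by (intro N_nonneg subspace_diff[OF sub] KA in_V)
    ultimately have "(\<lambda>n. N (K (s n) - K (t n))) \<longlonglongrightarrow> 0"
      by (rule null_squeeze)
    then show "t \<in> ns_Cauchy_rel V `` {s}"
      using Cauchy_if s t f by (simp add: ns_Cauchy_rel_def dist in_V)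
  qed

  have ex: "\<exists>s. s \<in> \<Phi> f" if f: "f \<in> ?C" for f
  proof -
    obtain h where h: "\<And>n::nat. h n \<in> S" and lim: "(\<lambda>n. N (h n - f)) \<longlonglongrightarrow> 0"
      using f by blast
    have "\<exists>u\<in>ns_carrier V. K u = h n" for n
      using h[of n] bij unfolding bij_betw_def by (metis imageE)
    then obtain s where "\<And>n. s n \<in> ns_carrier V" "\<And>n. K (s n) = h n"
      by metis
    then have "s \<in> \<Phi> f" using lim by (auto simp: \<Phi>_def)
    then show ?thesis by blast
  qed

  have \<Phi>_add: "(\<lambda>n. ns_add V (s n) (t n)) \<in> \<Phi> (f + g)"
    if st: "s \<in> \<Phi> f" "t \<in> \<Phi> g" and fg: "f \<in> A" "g \<in> A" for s t f g
  proof -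
    have in_V: "s n \<in> ns_carrier V" "t n \<in> ns_carrier V" for n
      using st by (auto simp: \<Phi>_def)
    have "(\<lambda>n. N (K (s n) - f) + N (K (t n) - g)) \<longlonglongrightarrow> 0"
      using st unfolding \<Phi>_def by (intro tendsto_add_zero) blast+
    moreover have "N (K (s n) + K (t n) - (f + g)) \<le> N (K (s n) - f) + N (K (t n) - g)" for n
      using N_triangle[of "K (s n) - f" "K (t n) - g"] in_V KA fg subspace_diff[OF sub]
      by (simp add: algebra_simps)
    moreover have "0 \<le> N (K (s n) + K (t n) - (f + g))" for n
      by (intro N_nonneg subspace_diff[OF sub] subspace_add[OF sub] KA in_V fg)
    ultimately have "(\<lambda>n. N (K (s n) + K (t n) - (f + g))) \<longlonglongrightarrow> 0"
      by (rule null_squeeze)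
    then show ?thesis
      using in_V by (auto simp: \<Phi>_def K_add add)
  qed

  have \<Phi>_scale: "(\<lambda>n. ns_scale V c (s n)) \<in> \<Phi> (sc c f)"
    if s: "s \<in> \<Phi> f" and f: "f \<in> A" for s f c
  proof -
    have in_V: "s n \<in> ns_carrier V" for n
      using s by (auto simp: \<Phi>_def)
    have "N (sc c (K (s n)) - sc c f) = norm c * N (K (s n) - f)" for n
      using N_scale[of "K (s n) - f" c] in_V KA f subspace_diff[OF sub]
      by (simp add: scale_right_diff_distrib)
    moreover have "(\<lambda>n. norm c * N (K (s n) - f)) \<longlonglongrightarrow> 0"
      using tendsto_mult_right_zero[of "\<lambda>n. N (K (s n) - f)" sequentially "norm c"] s by (simp add: \<Phi>_def)
    ultimately show ?thesis
      using in_V by (auto simp: \<Phi>_def K_scale scale)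
  qed

  have \<Phi>_norm: "(\<lambda>n. ns_norm V (s n)) \<longlonglongrightarrow> N f" if s: "s \<in> \<Phi> f" and f: "f \<in> A" for s f
  proof -
    have in_V: "s n \<in> ns_carrier V" for n
      using s by (auto simp: \<Phi>_def)
    have "norm (ns_norm V (s n) - N f) \<le> N (K (s n) - f)" for n
      using N_reverse_triangle[OF KA[OF in_V] f] by (simp add: K_norm in_V)
    moreover have "(\<lambda>n. N (K (s n) - f)) \<longlonglongrightarrow> 0"
      using s by (simp add: \<Phi>_def)
    ultimately have "(\<lambda>n. ns_norm V (s n) - N f) \<longlonglongrightarrow> 0"
      by (rule Lim_null_comparison[OF always_eventually[OF allI]])
    then show ?thesis by (simp add: LIM_zero_cancel)
  qed

  have inj: "f = g" if fg: "f \<in> ?C" "g \<in> ?C" and eq: "\<Phi> f = \<Phi> g" for f g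
  proof -
    obtain s where s: "s \<in> \<Phi> f" using ex fg by blast
    then have "s \<in> \<Phi> g" by (simp add: eq)
    with s fg show ?thesis
      by (intro limit_unique[of "\<lambda>n. K (s n)"]) (auto simp: \<Phi>_def KA)
  qed

  have surj: "\<exists>f\<in>?C. c = \<Phi> f" if c: "c \<in> ns_Cauchy_seqs V // ns_Cauchy_rel V" for c
  proof -
    obtain s where s: "s \<in> ns_Cauchy_seqs V" and c: "c = ns_Cauchy_rel V `` {s}"
      using c by (auto elim: quotientE)
    have in_V: "s n \<in> ns_carrier V" for n
      using s by (auto simp: ns_Cauchy_seqs_def)
    obtain f where f: "f \<in> A" and lim: "(\<lambda>n. N (K (s n) - f)) \<longlonglongrightarrow> 0"
      using complete[of "\<lambda>n. K (s n)"] s in_V KA by (auto simp: ns_Cauchy_seqs_def dist)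
    have "s \<in> \<Phi> f" using lim in_V by (auto simp: \<Phi>_def)
    moreover have "f \<in> ?C"
      using f lim in_V bij
      by (auto simp: bij_betw_def intro!: exI[of _ "\<lambda>n. K (s n)"])
    ultimately show ?thesis using coset f c by auto
  qed

  have "isometric_isomorphism \<Phi>
      \<lparr> ns_carrier = ?C, ns_add = (+), ns_scale = sc, ns_norm = N \<rparr> (ns_completion V)"
    unfolding isometric_isomorphism_def ns_completion_def nspace.simps
  proof (intro conjI ballI allI)
    have "\<Phi> f \<in> ns_Cauchy_seqs V // ns_Cauchy_rel V" if f: "f \<in> ?C" for f
    proof -
      obtain s where s: "s \<in> \<Phi> f" using ex f by blast
      have "f \<in> A" using f by simp
      then show ?thesis
        using quotientI[OF Cauchy_if[OF s], of "ns_Cauchy_rel V"] coset[OF s] by simp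
    qed
    then show "bij_betw \<Phi> ?C (ns_Cauchy_seqs V // ns_Cauchy_rel V)"
      unfolding bij_betw_def inj_on_def using inj surj by blast
  next
    fix f g assume fg: "f \<in> ?C" "g \<in> ?C"
    then have A: "f \<in> A" "g \<in> A" by auto
    have "ns_Cauchy_rel V `` {\<lambda>n. ns_add V (s n) (t n)} = \<Phi> (f + g)"
      if "s \<in> \<Phi> f" "t \<in> \<Phi> g" for s t
      by (rule coset[OF \<Phi>_add[OF that A] subspace_add[OF sub A]])
    then show "\<Phi> (f + g) = (\<Union>s\<in>\<Phi> f. \<Union>t\<in>\<Phi> g. ns_Cauchy_rel V `` {\<lambda>n. ns_add V (s n) (t n)})"
      using ex[OF fg(1)] ex[OF fg(2)] by auto
  next
    fix c f assume f: "f \<in> ?C"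
    then have A: "f \<in> A" by auto
    have "ns_Cauchy_rel V `` {\<lambda>n. ns_scale V c (s n)} = \<Phi> (sc c f)" if "s \<in> \<Phi> f" for s
      by (rule coset[OF \<Phi>_scale[OF that A] subspace_scale[OF sub A]])
    then show "\<Phi> (sc c f) = (\<Union>s\<in>\<Phi> f. ns_Cauchy_rel V `` {\<lambda>n. ns_scale V c (s n)})"
      using ex[OF f] by auto
  next
    fix f assume f: "f \<in> ?C"
    then have A: "f \<in> A" by auto
    show "(THE r. \<forall>s\<in>\<Phi> f. (\<lambda>n. ns_norm V (s n)) \<longlonglongrightarrow> r) = N f"
    proof (rule the_equality)
      show "\<forall>s\<in>\<Phi> f. (\<lambda>n. ns_norm V (s n)) \<longlonglongrightarrow> N f"
        using \<Phi>_norm A by blast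
      show "r = N f" if "\<forall>s\<in>\<Phi> f. (\<lambda>n. ns_norm V (s n)) \<longlonglongrightarrow> r" for r
        using ex[OF f] that \<Phi>_norm[OF _ A] LIMSEQ_unique by blast
    qed
  qed
  then show ?thesis unfolding isometrically_isomorphic_def by blast
qed

end


section \<open>The dual pairing of tensors with Lipschitz maps\<close>

interpretation fun_vs: vector_space "fun_scale :: 'k::field \<Rightarrow> ('a \<Rightarrow> 'k) \<Rightarrow> ('a \<Rightarrow> 'k)"
  by unfold_locales (auto simp: fun_scale_def algebra_simps fun_eq_iff)

interpretation dual_vs: vector_space
  "dual_scale :: 'k::{real_normed_field,banach} \<Rightarrow> ('e::banach \<Rightarrow>\<^sub>L 'k) \<Rightarrow> ('e \<Rightarrow>\<^sub>L 'k)"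
  by unfold_locales
    (auto intro!: blinfun_eqI simp: dual_scale_apply blinfun.add_left algebra_simps)

interpretation map_vs: vector_space
  "map_scale :: 'k::{real_normed_field,banach} \<Rightarrow> ('x \<Rightarrow> ('e::banach \<Rightarrow>\<^sub>L 'k)) \<Rightarrow> ('x \<Rightarrow> ('e \<Rightarrow>\<^sub>L 'k))"
  by unfold_locales (auto simp: map_scale_def fun_eq_iff
      dual_vs.scale_right_distrib dual_vs.scale_left_distrib)

lemma dual_space_subspace: "dual_vs.subspace (dual_space smul)"
  by (auto simp: dual_vs.subspace_def dual_space_def blinfun.add_left dual_scale_apply algebra_simps)

lemma norm_dual_scale_le: "norm (dual_scale c \<phi>) \<le> norm c * norm \<phi>"
  by (rule norm_blinfun_bound)
    (auto simp: dual_scale_apply norm_mult mult.assoc intro!: mult_left_mono norm_blinfun)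

lemma lip0_dual_subspace: "map_vs.subspace (lip0_dual smul z)"
proof (intro map_vs.subspaceI)
  show "0 \<in> lip0_dual smul z"
    using dual_vs.subspace_0[OF dual_space_subspace, of smul]
    by (auto simp: lip0_dual_def intro!: exI[of _ 0] lipschitz_onI)
next
  fix f h assume "f \<in> lip0_dual smul z" "h \<in> lip0_dual smul z"
  then show "f + h \<in> lip0_dual smul z"
    using dual_vs.subspace_add[OF dual_space_subspace, of _ smul]
    by (auto simp: lip0_dual_def plus_fun_def image_subset_iff intro: lipschitz_on_add)
next
  fix c f assume f: "f \<in> lip0_dual smul z"
  then obtain L where L: "L-lipschitz_on UNIV f" by (auto simp: lip0_dual_def)
  have "(norm c * L)-lipschitz_on UNIV (map_scale c f)"
  proof (rule lipschitz_onI)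
    fix x y
    have "dist (map_scale c f x) (map_scale c f y) = norm (dual_scale c (f x - f y))"
      by (simp add: dist_norm map_scale_def dual_vs.scale_right_diff_distrib)
    also have "\<dots> \<le> norm c * norm (f x - f y)"
      by (rule norm_dual_scale_le)
    also have "\<dots> \<le> norm c * (L * dist x y)"
      using lipschitz_onD[OF L, of x y] by (intro mult_left_mono) (auto simp: dist_norm)
    finally show "dist (map_scale c f x) (map_scale c f y) \<le> norm c * L * dist x y"
      by (simp add: mult.assoc)
  qed (use lipschitz_on_nonneg[OF L] in simp)
  with f show "map_scale c f \<in> lip0_dual smul z"
    using dual_vs.subspace_scale[OF dual_space_subspace, of _ smul]
    by (auto simp: lip0_dual_def map_scale_def image_subset_iff)
qed

lemma delta_in_lip_tensor: "delta smul z x y e \<in> lip_tensor smul z"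
  unfolding lip_tensor_def by (intro fun_vs.span_base) blast

lemma sum_delta_in_lip_tensor: "(\<Sum>i<n::nat. delta smul z (x i) (y i) (e i)) \<in> lip_tensor smul z"
  unfolding lip_tensor_def
  by (intro fun_vs.span_sum delta_in_lip_tensor[unfolded lip_tensor_def])

lemma sum_delta_apply:
  assumes "f \<in> lip0_dual smul z"
  shows "(\<Sum>i<n::nat. delta smul z (x i) (y i) (e i)) f = (\<Sum>i<n. blinfun_apply (f (x i) - f (y i)) (e i))"
  using assms by (simp add: sum_fun_apply delta_def)

lemma fun_scale_delta:
  "fun_scale c (delta smul z x y e) = delta smul z x y (smul c e)"
proof (rule ext)
  fix f
  have "f x - f y \<in> dual_space smul" if "f \<in> lip0_dual smul z"
    using that by (intro dual_vs.subspace_diff[OF dual_space_subspace]) (auto simp: lip0_dual_def)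
  then show "fun_scale c (delta smul z x y e) f = delta smul z x y (smul c e) f"
    by (auto simp: fun_scale_def delta_def dual_space_def)
qed

text \<open>Scalars can be moved into \<open>E\<close>, so linear combinations of elementary tensors are sums.\<close>

lemma lip_tensorE:
  assumes "u \<in> lip_tensor smul z"
  obtains n :: nat and x y e where "u = (\<Sum>i<n. delta smul z (x i) (y i) (e i))"
proof -
  have "\<exists>(n::nat) x y e. u = (\<Sum>i<n. delta smul z (x i) (y i) (e i))"
    using assms unfolding lip_tensor_def
  proof (induction rule: fun_vs.span_induct_alt)
    case base
    show ?case by (rule exI[of _ 0]) simp
  next
    case (step c d u)
    obtain X Y V where d: "d = delta smul z X Y V" using step by blast
    obtain n :: nat and x y e where u: "u = (\<Sum>i<n. delta smul z (x i) (y i) (e i))"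
      using step by blast
    have "fun_scale c d + u = (\<Sum>i<Suc n. delta smul z ((x(n := X)) i) ((y(n := Y)) i) ((e(n := smul c V)) i))"
      by (simp add: d u fun_scale_delta add.commute)
    then show ?case by blast
  qed
  then show ?thesis using that by blast
qed

lemma lip_tensor_apply_add:
  assumes "u \<in> lip_tensor smul z" "f \<in> lip0_dual smul z" "h \<in> lip0_dual smul z"
  shows "u (f + h) = u f + u h"
  using assms map_vs.subspace_add[OF lip0_dual_subspace assms(2,3)]
  by (elim lip_tensorE)
    (simp add: sum_delta_apply sum.distrib[symmetric] blinfun.add_left blinfun.diff_left algebra_simps)

lemma lip_tensor_apply_scale:
  assumes "u \<in> lip_tensor smul z" "f \<in> lip0_dual smul z"
  shows "u (map_scale c f) = c * u f"
  using assms map_vs.subspace_scale[OF lip0_dual_subspace assms(2)]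
  by (elim lip_tensorE)
    (simp add: sum_delta_apply sum_distrib_left map_scale_def dual_scale_apply blinfun.diff_left algebra_simps)

text \<open>The value \<open>0\<close> outside the tensor product matches the convention in \<open>assoc_fun\<close>, so that
  the two kinds of functionals can be equal as functions.\<close>

definition tensor_eval :: "('k::{real_normed_field,banach} \<Rightarrow> 'e::banach \<Rightarrow> 'e) \<Rightarrow>
    'x::metric_space \<Rightarrow> ('x \<Rightarrow> ('e \<Rightarrow>\<^sub>L 'k)) \<Rightarrow> ((('x \<Rightarrow> ('e \<Rightarrow>\<^sub>L 'k)) \<Rightarrow> 'k) \<Rightarrow> 'k)" where
  "tensor_eval smul z f = (\<lambda>u. if u \<in> lip_tensor smul z then u f else 0)"

lemma tensor_eval_add:
  assumes "f \<in> lip0_dual smul z" "h \<in> lip0_dual smul z"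
  shows "tensor_eval smul z (f + h) = tensor_eval smul z f + tensor_eval smul z h"
  using assms by (auto simp: tensor_eval_def fun_eq_iff lip_tensor_apply_add)

lemma tensor_eval_scale:
  assumes "f \<in> lip0_dual smul z"
  shows "tensor_eval smul z (map_scale c f) = fun_scale c (tensor_eval smul z f)"
  using assms by (auto simp: tensor_eval_def fun_eq_iff fun_scale_def lip_tensor_apply_scale)

lemma tensor_eval_0: "tensor_eval smul z 0 = 0"
  using tensor_eval_scale[of 0 smul z 0] map_vs.subspace_0[OF lip0_dual_subspace, of smul z]
  by simp

text \<open>The tensor \<open>\<delta>\<^bsub>(x,z)\<^esub> \<boxtimes> e\<close> recovers \<open>f x e\<close>, because \<open>f\<close> vanishes at \<open>z\<close>.\<close>

lemma tensor_eval_inj: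
  assumes f: "f \<in> lip0_dual smul z" and h: "h \<in> lip0_dual smul z"
    and eq: "tensor_eval smul z f = tensor_eval smul z h"
  shows "f = h"
proof (intro ext blinfun_eqI)
  fix x e
  have "delta smul z x z e f = delta smul z x z e h"
    using fun_cong[OF eq, of "delta smul z x z e"] by (simp add: tensor_eval_def delta_in_lip_tensor)
  then show "blinfun_apply (f x) e = blinfun_apply (h x) e"
    using f h by (simp add: delta_def lip0_dual_def)
qed

lemma tensor_eval_lip_dot:
  assumes "g \<in> lip_sharp z" "\<phi> \<in> dual_space smul"
  shows "tensor_eval smul z (lip_dot g \<phi>) = assoc_fun smul z g \<phi>"
proof
  fix u
  show "tensor_eval smul z (lip_dot g \<phi>) u = assoc_fun smul z g \<phi> u"
  proof (cases "u \<in> lip_tensor smul z")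
    case True
    then obtain n :: nat and x y e where u: "u = (\<Sum>i<n. delta smul z (x i) (y i) (e i))"
      by (rule lip_tensorE)
    show ?thesis
      using True assoc_fun_sum[OF assms] sum_delta_apply[OF lip_dot_in_lip0_dual[OF assms]]
      by (simp add: tensor_eval_def u lip_dot_def blinfun.diff_left dual_scale_apply left_diff_distrib)
  qed (simp add: tensor_eval_def assoc_fun_def)
qed


section \<open>Lipschitz maps of finite rank\<close>

lemma lip_dots_subset_lip0_dual:
  "map_vs.span {lip_dot g \<phi> | g \<phi>. g \<in> lip_sharp z \<and> \<phi> \<in> dual_space smul} \<subseteq> lip0_dual smul z"
  using lip_dot_in_lip0_dual by (intro map_vs.span_minimal lip0_dual_subspace) blast

text \<open>
  Gaussian elimination on the generators \<open>B\<close>. Scale some nonzero \<open>\<phi> \<in> B\<close> to \<open>\<phi>1\<close> with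
  \<open>\<phi>1 e = 1\<close> for a vector \<open>e\<close>, and split \<open>f = g \<cdot> \<phi>1 + (f - g \<cdot> \<phi>1)\<close> with
  \<open>g x = f x e\<close>. The coefficient \<open>g\<close> is an evaluation of \<open>f\<close> at a vector and therefore Lipschitz. The remainder takes values in the
  image of \<open>B\<close> under \<open>\<psi> \<mapsto> \<psi> - \<psi>(e) \<phi>1\<close>, and this projection kills \<open>\<phi>\<close>, so there is one
  generator less.
\<close>

lemma span_lip_dot_if_range_subset:
  assumes "finite B" "B \<subseteq> dual_space smul" "f \<in> lip0_dual smul z" "range f \<subseteq> dual_vs.span B"
  shows "f \<in> map_vs.span {lip_dot g \<phi> | g \<phi>. g \<in> lip_sharp z \<and> \<phi> \<in> dual_space smul}"
    (is "f \<in> map_vs.span ?D")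
  using assms
proof (induction "card B" arbitrary: B f rule: less_induct)
  case less
  show ?case
  proof (cases "B \<subseteq> {0}")
    case True
    then have "dual_vs.span B \<subseteq> {0}"
      using dual_vs.span_mono[OF True] by simp
    then have "f x = 0" for x using less.prems(4) by blast
    then have "f = 0" by (simp add: fun_eq_iff)
    then show ?thesis by (simp add: map_vs.span_zero)
  next
    case False
    then obtain \<phi> where \<phi>: "\<phi> \<in> B" "\<phi> \<noteq> 0" by blast
    then obtain e where e: "blinfun_apply \<phi> e \<noteq> 0"
      by (metis blinfun_eqI blinfun.zero_left)
    define \<phi>1 where "\<phi>1 = dual_scale (inverse (blinfun_apply \<phi> e)) \<phi>"
    have \<phi>1e: "blinfun_apply \<phi>1 e = 1" using e by (simp add: \<phi>1_def dual_scale_apply)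
    have \<phi>_eq: "\<phi> = dual_scale (blinfun_apply \<phi> e) \<phi>1" using e by (simp add: \<phi>1_def)
    have \<phi>1: "\<phi>1 \<in> dual_space smul"
      unfolding \<phi>1_def using \<phi> less.prems(2)
      by (intro dual_vs.subspace_scale[OF dual_space_subspace]) blast
    define P where "P \<psi> = \<psi> - dual_scale (blinfun_apply \<psi> e) \<phi>1" for \<psi>
    have P_dual: "P \<psi> \<in> dual_space smul" if "\<psi> \<in> dual_space smul" for \<psi>
      unfolding P_def using that \<phi>1
      by (intro dual_vs.subspace_diff dual_vs.subspace_scale dual_space_subspace)
    have P_add: "P (\<psi> + \<rho>) = P \<psi> + P \<rho>" for \<psi> \<rho>
      by (simp add: P_def blinfun.add_left dual_vs.scale_left_distrib)
    have P_scale: "P (dual_scale c \<psi>) = dual_scale c (P \<psi>)" for c \<psi>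
      by (simp add: P_def dual_scale_apply dual_vs.scale_right_diff_distrib)
    have P\<phi>: "P \<phi> = 0"
      by (subst \<phi>_eq, unfold P_scale) (simp add: P_def \<phi>1e)
    have P_span: "P \<psi> \<in> dual_vs.span (P ` (B - {\<phi>}))" if "\<psi> \<in> dual_vs.span B" for \<psi>
      using that
    proof (induction rule: dual_vs.span_induct_alt)
      case base
      show ?case by (simp add: P_def dual_vs.span_zero)
    next
      case (step c b \<psi>)
      have "P b \<in> dual_vs.span (P ` (B - {\<phi>}))"
        using step(1) P\<phi> by (cases "b = \<phi>") (auto simp: dual_vs.span_zero intro: dual_vs.span_base)
      then show ?case
        using step by (simp add: P_add P_scale dual_vs.span_add dual_vs.span_scale)
    qed
    obtain L where L: "L-lipschitz_on UNIV f" and f: "f z = 0"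
      using less.prems by (auto simp: lip0_dual_def)
    define g where "g x = blinfun_apply (f x) e" for x
    have "(L * norm e)-lipschitz_on UNIV g"
    proof (rule lipschitz_onI)
      fix x y
      have "dist (g x) (g y) \<le> norm (f x - f y) * norm e"
        unfolding dist_norm g_def blinfun.diff_left[symmetric] by (rule norm_blinfun)
      also have "\<dots> \<le> L * dist x y * norm e"
        using lipschitz_onD[OF L, of x y] by (intro mult_right_mono) (auto simp: dist_norm)
      finally show "dist (g x) (g y) \<le> L * norm e * dist x y" by (simp add: mult_ac)
    qed (use lipschitz_on_nonneg[OF L] in simp)
    then have "g \<in> lip_sharp z" using f by (auto simp: lip_sharp_def g_def)
    then have dot: "lip_dot g \<phi>1 \<in> ?D" using \<phi>1 by blast
    have "lip_dot g \<phi>1 \<in> lip0_dual smul z"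
      by (rule lip_dot_in_lip0_dual[OF \<open>g \<in> lip_sharp z\<close> \<phi>1])
    then have rest: "f - lip_dot g \<phi>1 \<in> lip0_dual smul z"
      using less.prems map_vs.subspace_diff[OF lip0_dual_subspace] by blast
    have "(f - lip_dot g \<phi>1) x = P (f x)" for x
      by (simp add: P_def g_def lip_dot_def)
    then have "range (f - lip_dot g \<phi>1) \<subseteq> dual_vs.span (P ` (B - {\<phi>}))"
      using P_span less.prems by auto
    moreover have "card (P ` (B - {\<phi>})) < card B"
      using card_image_le[of "B - {\<phi>}" P] card_Diff1_less[OF less.prems(1) \<phi>(1)] less.prems(1)
      by simp
    moreover have "P ` (B - {\<phi>}) \<subseteq> dual_space smul"
      using P_dual less.prems by auto
    ultimately have "f - lip_dot g \<phi>1 \<in> map_vs.span ?D"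
      using less.hyps rest less.prems(1) by blast
    from map_vs.span_add[OF this map_vs.span_base[OF dot]] show ?thesis by simp
  qed
qed

text \<open>For the inclusion from right to left, the span of the range lies in a finite-dimensional space
  and hence has a finite basis, chosen inside the range.\<close>

lemma lip0F_eq_span_lip_dot:
  "lip0F smul z = map_vs.span {lip_dot g \<phi> | g \<phi>. g \<in> lip_sharp z \<and> \<phi> \<in> dual_space smul}"
    (is "_ = map_vs.span ?D")
proof (intro equalityI subsetI)
  fix f assume f: "f \<in> lip0F smul z"
  then obtain B where B: "finite B" "dual_vs.span B = dual_vs.span (range f)"
    by (auto simp: lip0F_def)
  have f0: "f \<in> lip0_dual smul z" using f by (simp add: lip0F_def)
  have "range f \<subseteq> dual_space smul" using f0 by (simp add: lip0_dual_def)
  then have "dual_vs.span B \<subseteq> dual_space smul"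
    unfolding B by (rule dual_vs.span_minimal[OF _ dual_space_subspace])
  then have "B \<subseteq> dual_space smul" using dual_vs.span_superset by blast
  moreover have "range f \<subseteq> dual_vs.span B" unfolding B by (rule dual_vs.span_superset)
  ultimately show "f \<in> map_vs.span ?D"
    using span_lip_dot_if_range_subset B f0 by blast
next
  fix f assume f: "f \<in> map_vs.span ?D"
  have "\<exists>B. finite B \<and> range f \<subseteq> dual_vs.span B"
    using f
  proof (induction rule: map_vs.span_induct_alt)
    case base
    show ?case by (rule exI[of _ "{}"]) auto
  next
    case (step c d f)
    obtain g \<phi> where d: "d = lip_dot g \<phi>" using step by blast
    obtain B where B: "finite B" "range f \<subseteq> dual_vs.span B" using step by blast
    have "f x \<in> dual_vs.span (insert \<phi> B)" for x
      using B dual_vs.span_mono[of B "insert \<phi> B"] by blast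
    then have "(map_scale c d + f) x \<in> dual_vs.span (insert \<phi> B)" for x
      unfolding plus_fun_apply d map_scale_def lip_dot_def
      by (intro dual_vs.span_add dual_vs.span_scale) (auto intro: dual_vs.span_base)
    then have "range (map_scale c d + f) \<subseteq> dual_vs.span (insert \<phi> B)" by blast
    then show ?case using B by blast
  qed
  then obtain B where B: "finite B" "range f \<subseteq> dual_vs.span B" by blast
  obtain B' where B': "B' \<subseteq> range f" "dual_vs.independent B'" "range f \<subseteq> dual_vs.span B'"
    using dual_vs.maximal_independent_subset[of "range f"] by blast
  have "finite B'"
    using dual_vs.independent_span_bound[OF B(1) B'(2)] B'(1) B(2) by blast
  moreover have "dual_vs.span B' = dual_vs.span (range f)"
    using B' by (meson dual_vs.span_eq dual_vs.span_superset subset_trans)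
  ultimately show "f \<in> lip0F smul z"
    using f lip_dots_subset_lip0_dual by (fastforce simp: lip0F_def)
qed

lemma lip0F_subspace: "map_vs.subspace (lip0F smul z)"
  unfolding lip0F_eq_span_lip_dot by (rule map_vs.subspace_span)

lemma lip0F_subset_lip0_dual: "lip0F smul z \<subseteq> lip0_dual smul z"
  by (auto simp: lip0F_def)

lemma tensor_eval_image_lip0F: "tensor_eval smul z ` lip0F smul z = assoc_tensor smul z"
proof -
  let ?D = "{lip_dot g \<phi> | g \<phi>. g \<in> lip_sharp z \<and> \<phi> \<in> dual_space smul}"
  let ?G = "{assoc_fun smul z g \<phi> | g \<phi>. g \<in> lip_sharp z \<and> \<phi> \<in> dual_space smul}"
  have "tensor_eval smul z f \<in> fun_vs.span ?G \<and> f \<in> lip0_dual smul z"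
    if "f \<in> map_vs.span ?D" for f
    using that
  proof (induction rule: map_vs.span_induct_alt)
    case base
    show ?case
      by (simp only: tensor_eval_0 fun_vs.span_zero map_vs.subspace_0[OF lip0_dual_subspace] simp_thms)
  next
    case (step c d f)
    obtain g \<phi> where d: "d = lip_dot g \<phi>" "g \<in> lip_sharp z" "\<phi> \<in> dual_space smul"
      using step by blast
    have d0: "d \<in> lip0_dual smul z" using lip_dot_in_lip0_dual d by blast
    have "tensor_eval smul z d \<in> fun_vs.span ?G"
      using d by (auto simp: tensor_eval_lip_dot intro!: fun_vs.span_base)
    moreover have cd: "map_scale c d \<in> lip0_dual smul z"
      by (rule map_vs.subspace_scale[OF lip0_dual_subspace d0])
    moreover have f: "tensor_eval smul z f \<in> fun_vs.span ?G" "f \<in> lip0_dual smul z"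
      using step by blast+
    ultimately show ?case
      unfolding tensor_eval_add[OF cd f(2)] tensor_eval_scale[OF d0]
      by (intro conjI fun_vs.span_add fun_vs.span_scale map_vs.subspace_add[OF lip0_dual_subspace])
  qed
  moreover have "v \<in> tensor_eval smul z ` map_vs.span ?D" if "v \<in> fun_vs.span ?G" for v
    using that
  proof (induction rule: fun_vs.span_induct_alt)
    case base
    show ?case
      by (rule image_eqI[where x = 0]) (simp_all only: tensor_eval_0 map_vs.span_zero)
  next
    case (step c w v)
    obtain g \<phi> where w: "w = assoc_fun smul z g \<phi>" "g \<in> lip_sharp z" "\<phi> \<in> dual_space smul"
      using step by blast
    then have dot: "lip_dot g \<phi> \<in> map_vs.span ?D" by (auto intro!: map_vs.span_base)
    obtain f where f: "f \<in> map_vs.span ?D" "v = tensor_eval smul z f" using step by blast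
    have "f \<in> lip0_dual smul z" "lip_dot g \<phi> \<in> lip0_dual smul z"
      using f dot lip_dots_subset_lip0_dual by blast+
    then have "fun_scale c w + v = tensor_eval smul z (map_scale c (lip_dot g \<phi>) + f)"
      using w by (simp add: f(2) tensor_eval_add tensor_eval_scale tensor_eval_lip_dot
          map_vs.subspace_scale[OF lip0_dual_subspace])
    then show ?case
      using dot f by (auto intro!: imageI map_vs.span_add map_vs.span_scale)
  qed
  ultimately show ?thesis
    unfolding assoc_tensor_def lip0F_eq_span_lip_dot by blast
qed


section \<open>The norm of operators and the norm of functionals\<close>

locale dualizable_cross_norm = banach_over smul
  for smul :: "'k::{real_normed_field,banach} \<Rightarrow> 'e::banach \<Rightarrow> 'e" +
  fixes z :: "'x::metric_space"
    and \<alpha> :: "(('x \<Rightarrow> ('e \<Rightarrow>\<^sub>L 'k)) \<Rightarrow> 'k) \<Rightarrow> real"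
  assumes cross: "lip_cross_norm smul z \<alpha>"
    and dualizable: "dualizable smul z \<alpha>"
begin

lemma alpha_nonneg: "u \<in> lip_tensor smul z \<Longrightarrow> 0 \<le> \<alpha> u"
  and alpha_eq_0: "u \<in> lip_tensor smul z \<Longrightarrow> \<alpha> u = 0 \<longleftrightarrow> u = 0"
  and alpha_scale: "u \<in> lip_tensor smul z \<Longrightarrow> \<alpha> (fun_scale c u) = norm c * \<alpha> u"
  and alpha_delta: "\<alpha> (delta smul z x y e) = dist x y * norm e"
  using cross by (auto simp: lip_cross_norm_def)

text \<open>The defining inequality at a single elementary tensor, whose norm is known by the cross-norm
  property. It shows that \<open>\<alpha>\<close>-Lipschitz operators are Lipschitz, and it turns convergence in
  \<open>Lip_alpha\<close> into pointwise convergence.\<close>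

lemma norm_diff_le_if_lip_alpha_bound:
  assumes "lip_alpha_bound smul z \<alpha> f C"
  shows "norm (f x - f y) \<le> C * dist x y"
proof (rule norm_blinfun_bound)
  show "0 \<le> C * dist x y" using assms by (simp add: lip_alpha_bound_def)
  fix e
  have "norm (\<Sum>i<n. blinfun_apply (f x - f y) e) \<le> C * \<alpha> (\<Sum>i<n. delta smul z x y e)" for n :: nat
    using assms unfolding lip_alpha_bound_def by fast
  from this[of 1] show "norm (blinfun_apply (f x - f y) e) \<le> C * dist x y * norm e"
    by (simp add: alpha_delta mult_ac)
qed

lemma lip_alpha_subset_lip0_dual: "lip_alpha smul z \<alpha> \<subseteq> lip0_dual smul z"
proof
  fix f assume f: "f \<in> lip_alpha smul z \<alpha>"
  then obtain C where C: "lip_alpha_bound smul z \<alpha> f C" by (auto simp: lip_alpha_def)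
  then have "C-lipschitz_on UNIV f"
    by (intro lipschitz_onI)
      (auto simp: dist_norm[of "f _"] norm_diff_le_if_lip_alpha_bound, auto simp: lip_alpha_bound_def)
  then show "f \<in> lip0_dual smul z" using f by (auto simp: lip_alpha_def lip0_dual_def)
qed

text \<open>Passing from representations of a tensor to the tensor itself: the admissible constants are
  the bounds of the functional \<open>u \<mapsto> u f\<close> with respect to \<open>\<alpha>\<close>.\<close>

lemma lip_alpha_bound_iff:
  assumes "f \<in> lip0_dual smul z"
  shows "lip_alpha_bound smul z \<alpha> f C \<longleftrightarrow> 0 \<le> C \<and> (\<forall>u\<in>lip_tensor smul z. norm (u f) \<le> C * \<alpha> u)"
  unfolding lip_alpha_bound_def
proof (intro conj_cong refl iffI ballI allI)
  fix u assume *: "\<forall>(n::nat) x y e. norm (\<Sum>i<n. blinfun_apply (f (x i) - f (y i)) (e i))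
        \<le> C * \<alpha> (\<Sum>i<n. delta smul z (x i) (y i) (e i))" and u: "u \<in> lip_tensor smul z"
  from u show "norm (u f) \<le> C * \<alpha> u"
    by (rule lip_tensorE) (use * in \<open>simp add: sum_delta_apply[OF assms]\<close>)
next
  fix n :: nat and x y e
  assume "\<forall>u\<in>lip_tensor smul z. norm (u f) \<le> C * \<alpha> u"
  from bspec[OF this sum_delta_in_lip_tensor]
  show "norm (\<Sum>i<n. blinfun_apply (f (x i) - f (y i)) (e i))
        \<le> C * \<alpha> (\<Sum>i<n. delta smul z (x i) (y i) (e i))"
    by (simp only: sum_delta_apply[OF assms])
qed

lemma lip_alphaI:
  "f \<in> lip0_dual smul z \<Longrightarrow> lip_alpha_bound smul z \<alpha> f C \<Longrightarrow> f \<in> lip_alpha smul z \<alpha>"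
  by (auto simp: lip_alpha_def lip0_dual_def)

lemma Lip_alpha_le: "lip_alpha_bound smul z \<alpha> f C \<Longrightarrow> Lip_alpha smul z \<alpha> f \<le> C"
  unfolding Lip_alpha_def by (rule cInf_lower) (auto simp: lip_alpha_bound_def intro!: bdd_belowI[of _ 0])

text \<open>The infimum is attained: for \<open>\<alpha> u > 0\<close> every admissible constant is at least
  \<open>|u f| / \<alpha> u\<close>, and \<open>\<alpha> u = 0\<close> only for \<open>u = 0\<close>.\<close>

lemma lip_alpha_bound_Lip_alpha:
  assumes f: "f \<in> lip_alpha smul z \<alpha>"
  shows "lip_alpha_bound smul z \<alpha> f (Lip_alpha smul z \<alpha> f)"
proof -
  have f0: "f \<in> lip0_dual smul z" using f lip_alpha_subset_lip0_dual by blast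
  have ne: "{C. lip_alpha_bound smul z \<alpha> f C} \<noteq> {}" using f by (auto simp: lip_alpha_def)
  have "norm (u f) \<le> Lip_alpha smul z \<alpha> f * \<alpha> u" if u: "u \<in> lip_tensor smul z" for u
  proof (cases "u = 0")
    case True
    then show ?thesis using alpha_eq_0[OF u] by simp
  next
    case False
    then have pos: "\<alpha> u > 0" using alpha_nonneg[OF u] alpha_eq_0[OF u] by simp
    have "norm (u f) / \<alpha> u \<le> Lip_alpha smul z \<alpha> f"
      unfolding Lip_alpha_def
      using ne u pos by (intro cInf_greatest) (auto simp: lip_alpha_bound_iff[OF f0] divide_le_eq)
    then show ?thesis using pos by (simp add: divide_le_eq)
  qed
  moreover have "0 \<le> Lip_alpha smul z \<alpha> f"
    unfolding Lip_alpha_def using ne by (intro cInf_greatest) (auto simp: lip_alpha_bound_def)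
  ultimately show ?thesis by (simp add: lip_alpha_bound_iff[OF f0])
qed

lemma lip_alpha_bound_add:
  assumes "f \<in> lip_alpha smul z \<alpha>" "h \<in> lip_alpha smul z \<alpha>"
  shows "lip_alpha_bound smul z \<alpha> (f + h) (Lip_alpha smul z \<alpha> f + Lip_alpha smul z \<alpha> h)"
proof -
  have f0: "f \<in> lip0_dual smul z" "h \<in> lip0_dual smul z"
    using assms lip_alpha_subset_lip0_dual by blast+
  show ?thesis
    using lip_alpha_bound_Lip_alpha[OF assms(1)] lip_alpha_bound_Lip_alpha[OF assms(2)]
    unfolding lip_alpha_bound_iff[OF f0(1)] lip_alpha_bound_iff[OF f0(2)]
      lip_alpha_bound_iff[OF map_vs.subspace_add[OF lip0_dual_subspace f0]]
    by (auto simp: lip_tensor_apply_add f0 distrib_right intro!: norm_triangle_mono)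
qed

lemma lip_alpha_bound_scale:
  assumes "f \<in> lip_alpha smul z \<alpha>"
  shows "lip_alpha_bound smul z \<alpha> (map_scale c f) (norm c * Lip_alpha smul z \<alpha> f)"
proof -
  have f0: "f \<in> lip0_dual smul z"
    using assms lip_alpha_subset_lip0_dual by blast
  show ?thesis
    using lip_alpha_bound_Lip_alpha[OF assms]
    unfolding lip_alpha_bound_iff[OF f0]
      lip_alpha_bound_iff[OF map_vs.subspace_scale[OF lip0_dual_subspace f0]]
    by (auto simp: lip_tensor_apply_scale f0 norm_mult mult.assoc intro!: mult_left_mono)
qed

lemma lip_alpha_subspace: "map_vs.subspace (lip_alpha smul z \<alpha>)"
proof (intro map_vs.subspaceI)
  have zero: "(0 :: 'x \<Rightarrow> 'e \<Rightarrow>\<^sub>L 'k) \<in> lip0_dual smul z"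
    by (rule map_vs.subspace_0[OF lip0_dual_subspace])
  have "lip_alpha_bound smul z \<alpha> 0 0" by (simp add: lip_alpha_bound_def)
  then show "0 \<in> lip_alpha smul z \<alpha>" by (rule lip_alphaI[OF zero])
next
  fix f h assume fh: "f \<in> lip_alpha smul z \<alpha>" "h \<in> lip_alpha smul z \<alpha>"
  then have "f + h \<in> lip0_dual smul z"
    using lip_alpha_subset_lip0_dual by (intro map_vs.subspace_add[OF lip0_dual_subspace]) auto
  then show "f + h \<in> lip_alpha smul z \<alpha>"
    using lip_alpha_bound_add[OF fh] by (rule lip_alphaI)
next
  fix c f assume f: "f \<in> lip_alpha smul z \<alpha>"
  then have "map_scale c f \<in> lip0_dual smul z"
    using lip_alpha_subset_lip0_dual by (intro map_vs.subspace_scale[OF lip0_dual_subspace]) auto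
  then show "map_scale c f \<in> lip_alpha smul z \<alpha>"
    using lip_alpha_bound_scale[OF f] by (rule lip_alphaI)
qed

lemma norm_diff_le_Lip_alpha:
  assumes "f \<in> lip_alpha smul z \<alpha>"
  shows "norm (f x - f y) \<le> Lip_alpha smul z \<alpha> f * dist x y"
  by (rule norm_diff_le_if_lip_alpha_bound[OF lip_alpha_bound_Lip_alpha[OF assms]])

lemma Lip_alpha_nonneg: "f \<in> lip_alpha smul z \<alpha> \<Longrightarrow> 0 \<le> Lip_alpha smul z \<alpha> f"
  using lip_alpha_bound_Lip_alpha by (simp add: lip_alpha_bound_def)

lemma Lip_alpha_scale_le:
  "f \<in> lip_alpha smul z \<alpha> \<Longrightarrow> Lip_alpha smul z \<alpha> (map_scale c f) \<le> norm c * Lip_alpha smul z \<alpha> f"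
  by (rule Lip_alpha_le[OF lip_alpha_bound_scale])

lemma Lip_alpha_scale:
  assumes f: "f \<in> lip_alpha smul z \<alpha>"
  shows "Lip_alpha smul z \<alpha> (map_scale c f) = norm c * Lip_alpha smul z \<alpha> f"
proof (rule antisym[OF Lip_alpha_scale_le[OF f]])
  have cf: "map_scale c f \<in> lip_alpha smul z \<alpha>"
    by (rule map_vs.subspace_scale[OF lip_alpha_subspace f])
  \<comment> \<open>The inequality already proved, applied to \<open>inverse c\<close> and \<open>c f\<close>.\<close>
  show "norm c * Lip_alpha smul z \<alpha> f \<le> Lip_alpha smul z \<alpha> (map_scale c f)"
  proof (cases "c = 0")
    case True
    then show ?thesis using Lip_alpha_nonneg[OF cf] by simp
  next
    case False
    then show ?thesis
      using Lip_alpha_scale_le[OF cf, of "inverse c"] by (simp add: norm_inverse norm_divide field_simps)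
  qed
qed

sublocale lip_alpha: normed_subspace map_scale "lip_alpha smul z \<alpha>" "Lip_alpha smul z \<alpha>"
proof unfold_locales
  show "map_vs.subspace (lip_alpha smul z \<alpha>)" by (rule lip_alpha_subspace)
next
  fix f assume f: "f \<in> lip_alpha smul z \<alpha>" "Lip_alpha smul z \<alpha> f = 0"
  then show "f = 0"
    using norm_diff_le_Lip_alpha[OF f(1), of _ z] by (auto simp: fun_eq_iff lip_alpha_def)
qed (auto intro: Lip_alpha_nonneg Lip_alpha_scale Lip_alpha_le lip_alpha_bound_add)

text \<open>The pointwise limit exists because the operator space \<open>'e \<Rightarrow>\<^sub>L 'k\<close> is complete. The bound
  \<open>Lip_alpha (s m - s n) < \<epsilon>\<close> is a family of inequalities about finite sums of values, so letting
  \<open>n\<close> tend to infinity gives the bound \<open>\<epsilon>\<close> for \<open>s m - f\<close>. This yields both that \<open>f\<close> is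
  \<open>\<alpha>\<close>-Lipschitz and that the convergence is in norm.\<close>

lemma lip_alpha_complete:
  assumes s: "range s \<subseteq> lip_alpha smul z \<alpha>"
    and Cauchy: "\<forall>\<epsilon>>0. \<exists>M. \<forall>m\<ge>M. \<forall>n\<ge>M. Lip_alpha smul z \<alpha> (s m - s n) < \<epsilon>"
  shows "\<exists>f\<in>lip_alpha smul z \<alpha>. (\<lambda>n. Lip_alpha smul z \<alpha> (s n - f)) \<longlonglongrightarrow> 0"
proof -
  have sA: "s n \<in> lip_alpha smul z \<alpha>" for n using s by auto
  have diff: "s m - s n \<in> lip_alpha smul z \<alpha>" for m n
    by (intro map_vs.subspace_diff[OF lip_alpha_subspace] sA)
  have sz: "s n z = 0" "s n x \<in> dual_space smul" for n x
    using sA[of n] by (auto simp: lip_alpha_def)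
  have "Cauchy (\<lambda>n. s n x)" for x
  proof (rule CauchyI)
    fix \<epsilon> :: real assume \<epsilon>: "0 < \<epsilon>"
    \<comment> \<open>The summand \<open>1\<close> avoids a division by zero at \<open>x = z\<close>.\<close>
    define \<eta> where "\<eta> = \<epsilon> / (dist x z + 1)"
    have "\<eta> > 0" using \<epsilon> by (simp add: \<eta>_def add_nonneg_pos)
    then obtain M where M: "\<And>m n. m \<ge> M \<Longrightarrow> n \<ge> M \<Longrightarrow> Lip_alpha smul z \<alpha> (s m - s n) < \<eta>"
      using Cauchy by blast
    have "norm (s m x - s n x) < \<epsilon>" if "m \<ge> M" "n \<ge> M" for m n
    proof -
      have "norm (s m x - s n x) \<le> Lip_alpha smul z \<alpha> (s m - s n) * dist x z"
        using norm_diff_le_Lip_alpha[OF diff, of m n x z] by (simp add: sz)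
      also have "\<dots> \<le> \<eta> * dist x z"
        using M[OF that] by (intro mult_right_mono) auto
      also have "\<dots> < \<eta> * (dist x z + 1)" using \<open>\<eta> > 0\<close> by simp
      also have "\<dots> = \<epsilon>"
        using zero_le_dist[of x z] unfolding \<eta>_def by (simp add: add_nonneg_eq_0_iff)
      finally show ?thesis .
    qed
    then show "\<exists>M. \<forall>m\<ge>M. \<forall>n\<ge>M. norm (s m x - s n x) < \<epsilon>" by blast
  qed
  then have "(\<lambda>n. s n x) \<longlonglongrightarrow> lim (\<lambda>n. s n x)" for x
    by (simp add: Cauchy_convergent_iff convergent_LIMSEQ_iff)
  then obtain f where lim: "\<And>x. (\<lambda>n. s n x) \<longlonglongrightarrow> f x"
    by (rule that)
  have f_dual: "f x \<in> dual_space smul" for x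
    unfolding dual_space_def
  proof (intro CollectI allI)
    fix c e
    have "(\<lambda>n. blinfun_apply (s n x) (smul c e)) \<longlonglongrightarrow> blinfun_apply (f x) (smul c e)"
      by (intro tendsto_intros lim)
    moreover have "(\<lambda>n. blinfun_apply (s n x) (smul c e)) \<longlonglongrightarrow> c * blinfun_apply (f x) e"
      using sz(2) unfolding dual_space_def by (simp, intro tendsto_intros lim)
    ultimately show "blinfun_apply (f x) (smul c e) = c * blinfun_apply (f x) e"
      by (rule LIMSEQ_unique)
  qed
  have fz: "f z = 0" using lim[of z] by (simp add: sz LIMSEQ_const_iff)
  have bound: "\<exists>M. \<forall>m\<ge>M. lip_alpha_bound smul z \<alpha> (s m - f) \<epsilon>" if \<epsilon>: "\<epsilon> > 0" for \<epsilon>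
  proof -
    obtain M where M: "\<And>m n. m \<ge> M \<Longrightarrow> n \<ge> M \<Longrightarrow> Lip_alpha smul z \<alpha> (s m - s n) < \<epsilon>"
      using Cauchy \<epsilon> by blast
    have "lip_alpha_bound smul z \<alpha> (s m - f) \<epsilon>" if m: "m \<ge> M" for m
      unfolding lip_alpha_bound_def
    proof (intro conjI allI)
      show "0 \<le> \<epsilon>" using \<epsilon> by simp
      fix N :: nat and x y e
      let ?u = "\<Sum>i<N. delta smul z (x i) (y i) (e i)"
      have "(\<lambda>n. norm (\<Sum>i<N. blinfun_apply ((s m - s n) (x i) - (s m - s n) (y i)) (e i)))
          \<longlonglongrightarrow> norm (\<Sum>i<N. blinfun_apply ((s m - f) (x i) - (s m - f) (y i)) (e i))"
        unfolding fun_diff_def by (intro tendsto_intros lim)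
      moreover have "norm (\<Sum>i<N. blinfun_apply ((s m - s n) (x i) - (s m - s n) (y i)) (e i)) \<le> \<epsilon> * \<alpha> ?u"
        if n: "n \<ge> M" for n
      proof -
        have "norm (\<Sum>i<N. blinfun_apply ((s m - s n) (x i) - (s m - s n) (y i)) (e i))
            \<le> Lip_alpha smul z \<alpha> (s m - s n) * \<alpha> ?u"
          using lip_alpha_bound_Lip_alpha[OF diff] unfolding lip_alpha_bound_def by blast
        also have "\<dots> \<le> \<epsilon> * \<alpha> ?u"
          using M[OF m n] alpha_nonneg[OF sum_delta_in_lip_tensor] by (intro mult_right_mono) auto
        finally show ?thesis .
      qed
      ultimately show "norm (\<Sum>i<N. blinfun_apply ((s m - f) (x i) - (s m - f) (y i)) (e i)) \<le> \<epsilon> * \<alpha> ?u"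
        by (intro LIMSEQ_le_const2) auto
    qed
    then show ?thesis by blast
  qed
  have diff_f: "s m - f \<in> lip_alpha smul z \<alpha>" if "lip_alpha_bound smul z \<alpha> (s m - f) \<epsilon>" for m \<epsilon>
    using that
    by (auto simp: lip_alpha_def sz(1) fz intro!: dual_vs.subspace_diff[OF dual_space_subspace] sz(2) f_dual)
  obtain M where "lip_alpha_bound smul z \<alpha> (s M - f) 1" using bound[of 1] by auto
  then have f: "f \<in> lip_alpha smul z \<alpha>"
    using map_vs.subspace_diff[OF lip_alpha_subspace sA[of M] diff_f] by fastforce
  have "(\<lambda>n. Lip_alpha smul z \<alpha> (s n - f)) \<longlonglongrightarrow> 0"
  proof (rule LIMSEQ_I)
    fix r :: real assume r: "0 < r"
    then obtain M where M: "\<And>m. m \<ge> M \<Longrightarrow> lip_alpha_bound smul z \<alpha> (s m - f) (r / 2)"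
      using bound[of "r / 2"] by auto
    have "norm (Lip_alpha smul z \<alpha> (s m - f) - 0) < r" if "m \<ge> M" for m
      using Lip_alpha_le[OF M[OF that]] Lip_alpha_nonneg[OF diff_f[OF M[OF that]]] r by simp
    then show "\<exists>M. \<forall>m\<ge>M. norm (Lip_alpha smul z \<alpha> (s m - f) - 0) < r" by blast
  qed
  with f show ?thesis by blast
qed

text \<open>Dualizability says precisely that \<open>Lip g * norm \<phi>\<close> is an admissible constant.\<close>

lemma lip_dot_in_lip_alpha:
  assumes "g \<in> lip_sharp z" "\<phi> \<in> dual_space smul"
  shows "lip_dot g \<phi> \<in> lip_alpha smul z \<alpha>"
proof (rule lip_alphaI[OF lip_dot_in_lip0_dual[OF assms]])
  have "0 \<le> Lip g"
    unfolding Lip_def using assms(1) lipschitz_on_nonneg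
    by (intro cInf_greatest) (auto simp: lip_sharp_def)
  moreover have "norm (\<Sum>i<n. blinfun_apply (lip_dot g \<phi> (x i) - lip_dot g \<phi> (y i)) (e i))
      \<le> Lip g * norm \<phi> * \<alpha> (\<Sum>i<n. delta smul z (x i) (y i) (e i))" for n :: nat and x y e
    using dualizable assms
    by (simp add: dualizable_def lip_dot_def blinfun.diff_left dual_scale_apply left_diff_distrib[symmetric])
  ultimately show "lip_alpha_bound smul z \<alpha> (lip_dot g \<phi>) (Lip g * norm \<phi>)"
    by (simp add: lip_alpha_bound_def)
qed

lemma lip0F_subset_lip_alpha: "lip0F smul z \<subseteq> lip_alpha smul z \<alpha>"
  unfolding lip0F_eq_span_lip_dot
  using lip_dot_in_lip_alpha by (intro map_vs.span_minimal lip_alpha_subspace) blast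

text \<open>The usual equality of the best constant and the supremum over the unit ball, by normalizing
  \<open>u \<noteq> 0\<close> to \<open>w = u / \<alpha> u\<close>. The tensor \<open>u = 0\<close> keeps the supremum from being taken over
  the empty set.\<close>

lemma assoc_norm_tensor_eval:
  assumes f: "f \<in> lip_alpha smul z \<alpha>"
  shows "assoc_norm smul z \<alpha> (tensor_eval smul z f) = Lip_alpha smul z \<alpha> f"
proof -
  have f0: "f \<in> lip0_dual smul z" using f lip_alpha_subset_lip0_dual by blast
  let ?S = "{norm (u f) | u. u \<in> lip_tensor smul z \<and> \<alpha> u \<le> 1}"
  have S: "assoc_norm smul z \<alpha> (tensor_eval smul z f) = Sup ?S"
    unfolding assoc_norm_def tensor_eval_def by (rule arg_cong[where f = Sup]) auto
  have zero: "(0 :: ('x \<Rightarrow> 'e \<Rightarrow>\<^sub>L 'k) \<Rightarrow> 'k) \<in> lip_tensor smul z"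
    unfolding lip_tensor_def by (rule fun_vs.span_zero)
  have le: "r \<le> Lip_alpha smul z \<alpha> f" if "r \<in> ?S" for r
  proof -
    obtain u where u: "u \<in> lip_tensor smul z" "\<alpha> u \<le> 1" "r = norm (u f)" using \<open>r \<in> ?S\<close> by blast
    have "norm (u f) \<le> Lip_alpha smul z \<alpha> f * \<alpha> u"
      using lip_alpha_bound_Lip_alpha[OF f] u by (simp add: lip_alpha_bound_iff[OF f0])
    also have "\<dots> \<le> Lip_alpha smul z \<alpha> f * 1"
      using u Lip_alpha_nonneg[OF f] by (intro mult_left_mono)
    finally show ?thesis using u by simp
  qed
  then have bdd: "bdd_above ?S" by (rule bdd_aboveI)
  have "\<alpha> 0 = 0" using alpha_eq_0[OF zero] by simp
  then have S0: "0 \<in> ?S" using zero by (auto intro!: exI[of _ "0 :: ('x \<Rightarrow> 'e \<Rightarrow>\<^sub>L 'k) \<Rightarrow> 'k"])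
  have "lip_alpha_bound smul z \<alpha> f (Sup ?S)"
    unfolding lip_alpha_bound_iff[OF f0]
  proof (intro conjI ballI)
    show "0 \<le> Sup ?S" by (rule cSup_upper[OF S0 bdd])
    fix u assume u: "u \<in> lip_tensor smul z"
    show "norm (u f) \<le> Sup ?S * \<alpha> u"
    proof (cases "u = 0")
      case True
      then show ?thesis using \<open>\<alpha> 0 = 0\<close> by simp
    next
      case False
      then have pos: "\<alpha> u > 0" using alpha_nonneg[OF u] alpha_eq_0[OF u] by simp
      define w where "w = fun_scale (of_real (inverse (\<alpha> u))) u"
      have w: "w \<in> lip_tensor smul z"
        using u unfolding w_def lip_tensor_def by (rule fun_vs.span_scale)
      have "\<alpha> w = 1" using pos by (simp add: w_def alpha_scale[OF u] norm_inverse)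
      then have "norm (w f) \<le> Sup ?S" using w by (intro cSup_upper[OF _ bdd]) auto
      moreover have "norm (w f) = norm (u f) / \<alpha> u"
        using pos by (simp add: w_def fun_scale_def norm_mult norm_inverse divide_inverse)
      ultimately show ?thesis using pos by (simp add: divide_le_eq)
    qed
  qed
  then have "Lip_alpha smul z \<alpha> f \<le> Sup ?S" by (rule Lip_alpha_le)
  moreover have "Sup ?S \<le> Lip_alpha smul z \<alpha> f"
    using S0 le by (intro cSup_least) auto
  ultimately show ?thesis unfolding S by simp
qed

lemma tensor_eval_isometric_isomorphism:
  "isometric_isomorphism (tensor_eval smul z) (lip0F_space smul z \<alpha>) (assoc_space smul z \<alpha>)"
  unfolding isometric_isomorphism_def lip0F_space_def assoc_space_def nspace.simps
proof (intro conjI ballI allI)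
  show "bij_betw (tensor_eval smul z) (lip0F smul z) (assoc_tensor smul z)"
    unfolding bij_betw_def inj_on_def
    using tensor_eval_inj lip0F_subset_lip0_dual tensor_eval_image_lip0F by blast
next
  fix f assume "f \<in> lip0F smul z"
  then show "assoc_norm smul z \<alpha> (tensor_eval smul z f) = Lip_alpha smul z \<alpha> f"
    using lip0F_subset_lip_alpha by (intro assoc_norm_tensor_eval) blast
qed (use lip0F_subset_lip0_dual in \<open>auto intro!: tensor_eval_add tensor_eval_scale\<close>)

end

theorem theorem4p3:
  fixes smul :: "'k::{real_normed_field,banach} \<Rightarrow> 'e::banach \<Rightarrow> 'e"
    and z :: "'x::metric_space"
    and \<alpha> :: "(('x \<Rightarrow> ('e \<Rightarrow>\<^sub>L 'k)) \<Rightarrow> 'k) \<Rightarrow> real"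
  assumes "banach_over smul"
    and "lip_cross_norm smul z \<alpha>"
    and "dualizable smul z \<alpha>"
  shows "(\<exists>K. isometric_isomorphism K (assoc_space smul z \<alpha>) (lip0F_space smul z \<alpha>) \<and>
            (\<forall>(m::nat) g \<phi>. (\<forall>j<m. g j \<in> lip_sharp z \<and> \<phi> j \<in> dual_space smul) \<longrightarrow>
               K (\<Sum>j<m. assoc_fun smul z (g j) (\<phi> j)) = (\<Sum>j<m. lip_dot (g j) (\<phi> j)))) \<and>
         isometrically_isomorphic (lip_approximable_space smul z \<alpha>)
           (ns_completion (assoc_space smul z \<alpha>))"
proof -
  interpret dualizable_cross_norm smul z \<alpha>
    using assms by (simp add: dualizable_cross_norm_def dualizable_cross_norm_axioms_def)
  define K where "K = inv_into (lip0F smul z) (tensor_eval smul z)"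
  have carrier: "ns_carrier (lip0F_space smul z \<alpha>) = lip0F smul z"
    by (simp add: lip0F_space_def)
  have K: "isometric_isomorphism K (assoc_space smul z \<alpha>) (lip0F_space smul z \<alpha>)"
    unfolding K_def
    by (rule isometric_isomorphism_inv_into[OF tensor_eval_isometric_isomorphism, unfolded carrier])
      (auto simp: lip0F_space_def intro: map_vs.subspace_add[OF lip0F_subspace]
        map_vs.subspace_scale[OF lip0F_subspace])
  have K_eval: "K (tensor_eval smul z f) = f" if "f \<in> lip0F smul z" for f
    using tensor_eval_isometric_isomorphism that
    by (simp add: K_def isometric_isomorphism_def bij_betw_def carrier)
  have K_sum: "K (\<Sum>j<m. assoc_fun smul z (g j) (\<phi> j)) = (\<Sum>j<m. lip_dot (g j) (\<phi> j))"
    if mem: "\<forall>j<m. g j \<in> lip_sharp z \<and> \<phi> j \<in> dual_space smul" for m :: nat and g \<phi>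
  proof -
    have dot: "lip_dot (g j) (\<phi> j) \<in> lip0F smul z" if "j < m" for j
      using mem that unfolding lip0F_eq_span_lip_dot by (intro map_vs.span_base) blast
    have sum: "(\<Sum>j<k. lip_dot (g j) (\<phi> j)) \<in> lip0F smul z" if "k \<le> m" for k
      using dot that by (intro map_vs.subspace_sum[OF lip0F_subspace]) auto
    have "tensor_eval smul z (\<Sum>j<k. lip_dot (g j) (\<phi> j)) = (\<Sum>j<k. assoc_fun smul z (g j) (\<phi> j))"
      if "k \<le> m" for k
      using that
    proof (induction k)
      case 0
      show ?case
        by (simp only: lessThan_0 sum.empty tensor_eval_0)
    next
      case (Suc k)
      have "tensor_eval smul z ((\<Sum>j<k. lip_dot (g j) (\<phi> j)) + lip_dot (g k) (\<phi> k))
          = tensor_eval smul z (\<Sum>j<k. lip_dot (g j) (\<phi> j)) + tensor_eval smul z (lip_dot (g k) (\<phi> k))"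
        using Suc.prems sum[of k] dot[of k] lip0F_subset_lip0_dual[of smul z]
        by (intro tensor_eval_add) auto
      also have "tensor_eval smul z (lip_dot (g k) (\<phi> k)) = assoc_fun smul z (g k) (\<phi> k)"
        using mem Suc.prems by (intro tensor_eval_lip_dot) auto
      finally show ?case
        using Suc by (simp only: sum.lessThan_Suc Suc_leD)
    qed
    then show ?thesis using K_eval[OF sum[of m]] by simp
  qed
  have completion: "isometrically_isomorphic (lip_approximable_space smul z \<alpha>)
      (ns_completion (assoc_space smul z \<alpha>))"
    unfolding lip_approximable_space_def lip_approximable_def
  proof (rule lip_alpha.closure_iso_completion)
    show "isometric_isomorphism K (assoc_space smul z \<alpha>)
      \<lparr> ns_carrier = lip0F smul z, ns_add = (+), ns_scale = map_scale, ns_norm = Lip_alpha smul z \<alpha> \<rparr>"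
      using K by (simp add: lip0F_space_def)
    show "\<exists>f\<in>lip_alpha smul z \<alpha>. (\<lambda>n. Lip_alpha smul z \<alpha> (s n - f)) \<longlonglongrightarrow> 0"
      if "range s \<subseteq> lip_alpha smul z \<alpha>"
        "\<forall>\<epsilon>>0. \<exists>M. \<forall>m\<ge>M. \<forall>n\<ge>M. Lip_alpha smul z \<alpha> (s m - s n) < \<epsilon>" for s
      using that by (rule lip_alpha_complete)
    show "lip0F smul z \<subseteq> lip_alpha smul z \<alpha>" by (rule lip0F_subset_lip_alpha)
  qed (simp_all only: assoc_space_def assoc_tensor_def fun_vs.span_add fun_vs.span_scale nspace.simps)
  show ?thesis
    by (intro conjI exI[of _ K] allI impI K K_sum completion) blast+
qed

end
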